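(* Let $X=z/Z$. Then $$X^{2}(1-4X)(1-12X+16X^{2})\frac{d^{3}Z}{dX^{3}}+3X(1-24X+128X^{2}-160X^{3})\frac{d^{2}Z}{dX^{2}}+(1-56X+464X^{2}-784X^{3})\frac{dZ}{dX}-4(1-20X+54X^{2})Z=0.$$
   Context: Let $q=e^{2\pi i\tau}$ with $\Im\tau>0$, and let $\eta(\tau)=q^{1/24}\prod_{j=1}^{\infty}(1-q^{j})$, $\eta_\ell=\eta(\ell\tau)$. Define $$z=\eta_2^2\eta_{10}^2,\qquad Z=\left(\sum_{m=-\infty}^{\infty}\sum_{n=-\infty}^{\infty}q^{m^{2}+5n^{2}}\right)^{2}.$$ Both $z$ and $Z$ are functions of $q$, and $X=z/Z=q+O(q^2)$. The derivative $d/dX$ is taken along the parametrization, i.e. $\frac{dF}{dX}=\frac{dF}{dq}\big/\frac{dX}{dq}$; in particular $Z$ may be regarded as an analytic function of $X$ near $X=0$. *)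

theory Defs
  imports "HOL-Analysis.Analysis"
begin

definition nome :: "complex \<Rightarrow> complex" where
  "nome \<tau> = exp (2 * of_real pi * \<i> * \<tau>)"

text \<open>The prefactor \<open>q\<^bsup>1/24\<^esup>\<close> is not a function of \<open>q\<close>: it means \<open>exp (2 \<pi> \<i> \<tau> / 24)\<close>,
  so \<open>eta\<close> has to be a function of \<open>\<tau>\<close>.\<close>

definition eta :: "complex \<Rightarrow> complex" where
  "eta \<tau> = exp (2 * of_real pi * \<i> * \<tau> / 24) * (\<Prod>j. 1 - nome \<tau> ^ Suc j)"

definition eta_sub :: "nat \<Rightarrow> complex \<Rightarrow> complex" where
  "eta_sub l \<tau> = eta (of_nat l * \<tau>)"

text \<open>For \<open>0 < \<bar>q\<bar> < 1\<close>, \<open>Ln q / (2 \<pi> \<i>)\<close> is one of the \<open>\<tau>\<close> with \<open>nome \<tau> = q\<close>;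
  the value does not depend on this choice (lemma \<open>z_nome\<close> below), so there is no branch cut.
  The puncture \<open>q = 0\<close> is filled in with the value of the power series \<open>q + O(q\<^sup>2)\<close> of \<open>z\<close>.\<close>

definition z :: "complex \<Rightarrow> complex" where
  "z q = (if q = 0 then 0
          else let \<tau> = Ln q / (2 * of_real pi * \<i>) in eta_sub 2 \<tau> ^ 2 * eta_sub 10 \<tau> ^ 2)"

definition Z :: "complex \<Rightarrow> complex" where
  "Z q = (\<Sum>\<^sub>\<infinity>m::int. \<Sum>\<^sub>\<infinity>n::int. q ^ nat (m\<^sup>2 + 5 * n\<^sup>2)) ^ 2"

definition X :: "complex \<Rightarrow> complex" where
  "X q = z q / Z q"

text \<open>The derivative \<open>d/dX\<close> along the parametrization by \<open>q\<close>: functions of \<open>q\<close> are mapped to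
  functions of \<open>q\<close>.\<close>

definition dX :: "(complex \<Rightarrow> complex) \<Rightarrow> complex \<Rightarrow> complex" where
  "dX F q = deriv F q / deriv X q"

lemma nome_mult: "nome (of_nat l * \<tau>) = nome \<tau> ^ l"
  unfolding nome_def by (simp add: exp_of_nat_mult [symmetric] mult_ac)

lemma eta_prefactor:
  "exp (2 * of_real pi * \<i> * (of_nat 2 * \<tau>) / 24) ^ 2 *
   exp (2 * of_real pi * \<i> * (of_nat 10 * \<tau>) / 24) ^ 2 = nome \<tau>"
  unfolding nome_def exp_of_nat_mult [symmetric] exp_add [symmetric]
  by (rule arg_cong [where f = exp]) (simp add: field_simps)

lemma eta_quotient_nome:
  "eta_sub 2 \<tau> ^ 2 * eta_sub 10 \<tau> ^ 2 =
   nome \<tau> * (\<Prod>j. 1 - (nome \<tau> ^ 2) ^ Suc j) ^ 2 * (\<Prod>j. 1 - (nome \<tau> ^ 10) ^ Suc j) ^ 2"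
proof -
  have "eta_sub 2 \<tau> ^ 2 * eta_sub 10 \<tau> ^ 2 =
     (exp (2 * of_real pi * \<i> * (of_nat 2 * \<tau>) / 24) ^ 2 *
      exp (2 * of_real pi * \<i> * (of_nat 10 * \<tau>) / 24) ^ 2) *
     (\<Prod>j. 1 - (nome \<tau> ^ 2) ^ Suc j) ^ 2 * (\<Prod>j. 1 - (nome \<tau> ^ 10) ^ Suc j) ^ 2"
    unfolding eta_sub_def eta_def nome_mult power_mult_distrib by (simp only: mult_ac)
  then show ?thesis
    unfolding eta_prefactor .
qed

lemma z_nome: "z (nome \<tau>) = eta_sub 2 \<tau> ^ 2 * eta_sub 10 \<tau> ^ 2"
proof -
  have ne: "nome \<tau> \<noteq> 0"
    by (simp add: nome_def)
  have "nome (Ln (nome \<tau>) / (2 * of_real pi * \<i>)) = nome \<tau>"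
    unfolding nome_def [of "Ln (nome \<tau>) / (2 * of_real pi * \<i>)"] using ne by simp
  then show ?thesis
    using ne by (simp add: z_def Let_def eta_quotient_nome)
qed

end

theory Submission
  imports Defs "HOL-Complex_Analysis.Complex_Analysis"
begin

text \<open>
  By the Jacobi triple product, \<open>Z\<close> and \<open>z\<close> are products of the theta functions
  \<open>phi q = \<Sum> q\<^bsup>n\<^sup>2\<^esup>\<close> and \<open>psi q\<close> with \<open>2 psi q = \<Sum> q\<^bsup>n\<^sup>2+n\<^esup>\<close> at \<open>q\<close> and \<open>q\<^sup>5\<close>; up to powers of
  \<open>q\<close>, the Jacobi theta functions \<open>\<theta>\<^sub>3, \<theta>\<^sub>4, \<theta>\<^sub>2\<close> are \<open>phi q\<close>, \<open>phi (- q)\<close>, \<open>2 psi q\<close>. Their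
  differential equations follow from the duplication formulas: the defect of each
  equation at \<open>q\<close> is a multiple of its defect at \<open>q\<^sup>2\<close>, and iterating \<open>q \<mapsto> q\<^sup>2\<close> reduces to \<open>q = 0\<close>.

  Splitting the Gaussian integers modulo \<open>2 + i\<close> writes \<open>\<theta>\<^sub>i(q)\<^sup>2 - \<theta>\<^sub>i(q\<^sup>5)\<^sup>2\<close> as a product. So the ratios
  \<open>s\<^sub>i = \<theta>\<^sub>i(q) / \<theta>\<^sub>i(q\<^sup>5)\<close> satisfy \<open>\<Prod> (s\<^sub>i\<^sup>2 - 1) = - 16\<close>, and Jacobi's quartic identity at \<open>q\<^sup>5\<close> becomes
  a second relation; together they force \<open>(1 + s\<^sub>2) (1 - s\<^sub>3) (1 + s\<^sub>4) = (1 - s\<^sub>2) (1 + s\<^sub>3) (1 - s\<^sub>4) = - 4\<close>.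
  With \<open>m = s\<^sub>3\<^sup>2\<close> this gives \<open>16 m X = (5 - m) (m - 1)\<close>. For \<open>D = q d/dq\<close> one obtains
  \<open>(D X)\<^sup>2 = X\<^sup>2 Z\<^sup>2 (1 - 4 X) (1 - 12 X + 16 X\<^sup>2)\<close> and
  \<open>2 Z D\<^sup>2 Z - 3 (D Z)\<^sup>2 = Z\<^sup>4 (8 X - 80 X\<^sup>2 + 144 X\<^sup>3)\<close>, that is, a Riccati equation for
  \<open>V = (dZ/dX) / Z\<close>. Its derivative is the third order equation.
\<close>

section \<open>The Jacobi triple product\<close>

definition qp :: "complex \<Rightarrow> complex \<Rightarrow> complex" where
  "qp a b = (\<Prod>k. 1 - a * b ^ k)"

lemma qp_convergent:
  fixes a b :: complex
  assumes "norm b < 1"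
  shows "convergent_prod (\<lambda>k. 1 - a * b ^ k)"
proof -
  have "summable (\<lambda>k. norm a * norm b ^ k)"
    using assms by (intro summable_mult summable_geometric) auto
  then have "abs_convergent_prod (\<lambda>k. 1 - a * b ^ k)"
    unfolding abs_convergent_prod_conv_summable by (simp add: norm_mult norm_power)
  then show ?thesis
    by (rule abs_convergent_prod_imp_convergent_prod)
qed

lemma qp_nonzero:
  assumes "norm b < 1" "norm a < 1"
  shows "qp a b \<noteq> 0"
  unfolding qp_def
proof (rule prodinf_nonzero[OF qp_convergent[OF assms(1)]])
  fix k
  have "norm (a * b ^ k) \<le> norm a * 1"
    unfolding norm_mult norm_power using assms by (intro mult_left_mono power_le_one) auto
  then have "norm (a * b ^ k) < norm (1::complex)"
    using assms by simp
  then show "1 - a * b ^ k \<noteq> 0" by auto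
qed

lemma qp_tendsto:
  assumes "norm b < 1"
  shows "(\<lambda>N. \<Prod>k<N. 1 - a * b ^ k) \<longlonglongrightarrow> qp a b"
  using convergent_prod_LIMSEQ[OF qp_convergent[OF assms]]
  unfolding qp_def LIMSEQ_lessThan_iff_atMost by simp

lemma qp_0_left [simp]: "qp 0 b = 1"
  by (simp add: qp_def)

text \<open>Every exponent \<open>k\<close> is \<open>m * n + i\<close> with \<open>i < n\<close>;
  grouping the factors by the residue \<open>i\<close> gives products with base
  \<open>b ^ n\<close>.\<close>

lemma qp_split:
  assumes "norm b < 1" "n > 0"
  shows "qp a b = (\<Prod>i<n. qp (a * b ^ i) (b ^ n))"
proof -
  have bn: "norm (b ^ n) < 1"
    using assms by (simp add: norm_power power_less_one_iff)
  have eq: "(\<Prod>i<n. \<Prod>k<N. 1 - (a * b ^ i) * (b ^ n) ^ k) = (\<Prod>k<N * n. 1 - a * b ^ k)" for N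
  proof -
    have "(\<Prod>k<N * n. 1 - a * b ^ k) = (\<Prod>m<N. \<Prod>k\<in>{m * n..<m * n + n}. 1 - a * b ^ k)"
      by (rule prod.nat_group [symmetric])
    also have "\<dots> = (\<Prod>m<N. \<Prod>i<n. 1 - (a * b ^ i) * (b ^ n) ^ m)"
    proof (rule prod.cong[OF refl])
      fix m
      show "(\<Prod>k\<in>{m * n..<m * n + n}. 1 - a * b ^ k) = (\<Prod>i<n. 1 - (a * b ^ i) * (b ^ n) ^ m)"
        by (rule prod.reindex_bij_witness[of _ "\<lambda>i. m * n + i" "\<lambda>k. k - m * n"])
           (auto simp: mult_ac simp flip: power_mult power_add)
    qed
    finally show ?thesis
      by (subst prod.swap) simp
  qed
  have "(\<lambda>N. \<Prod>i<n. \<Prod>k<N. 1 - (a * b ^ i) * (b ^ n) ^ k) \<longlonglongrightarrow> (\<Prod>i<n. qp (a * b ^ i) (b ^ n))"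
    by (intro tendsto_prod qp_tendsto bn)
  moreover have "(\<lambda>N. \<Prod>k<N * n. 1 - a * b ^ k) \<longlonglongrightarrow> qp a b"
    using LIMSEQ_subseq_LIMSEQ[OF qp_tendsto[OF assms(1)], of "\<lambda>N. N * n"] assms(2)
    by (simp add: o_def strict_mono_def)
  ultimately show ?thesis
    unfolding eq by (rule LIMSEQ_unique[symmetric])
qed

lemma qp_mult_minus:
  assumes "norm b < 1"
  shows "qp a b * qp (- a) b = qp (a ^ 2) (b ^ 2)"
proof -
  have b2: "norm (b ^ 2) < 1"
    using assms by (simp add: norm_power power_less_one_iff)
  have "(\<lambda>N. (\<Prod>k<N. 1 - a * b ^ k) * (\<Prod>k<N. 1 - (- a) * b ^ k)) \<longlonglongrightarrow> qp a b * qp (- a) b"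
    by (intro tendsto_mult qp_tendsto assms)
  moreover have "(\<Prod>k<N. 1 - a * b ^ k) * (\<Prod>k<N. 1 - (- a) * b ^ k)
                 = (\<Prod>k<N. 1 - a ^ 2 * (b ^ 2) ^ k)" for N
    unfolding prod.distrib [symmetric]
    by (rule prod.cong) (auto simp: algebra_simps power2_eq_square power_mult_distrib)
  ultimately show ?thesis
    using qp_tendsto[OF b2, of "a ^ 2"] LIMSEQ_unique by auto
qed

text \<open>On a closed disc the maxima of the norms of \<open>f\<close> and \<open>g\<close> give a
  geometric majorant with ratio below 1, so the partial products converge locally uniformly.\<close>

lemma holomorphic_qp:
  assumes "open S" "f holomorphic_on S" "g holomorphic_on S" "\<And>q. q \<in> S \<Longrightarrow> norm (g q) < 1"
  shows "(\<lambda>q. qp (f q) (g q)) holomorphic_on S"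
proof (rule holomorphic_uniform_sequence[OF assms(1)])
  show "(\<lambda>q. \<Prod>k<n. 1 - f q * g q ^ k) holomorphic_on S" for n
    using assms by (intro holomorphic_intros)
next
  fix x assume x: "x \<in> S"
  then obtain d where d: "d > 0" "cball x d \<subseteq> S"
    using assms(1) open_contains_cball_eq by blast
  let ?K = "cball x d"
  have cf: "continuous_on ?K f" and cg: "continuous_on ?K g"
    using assms d by (meson continuous_on_subset holomorphic_on_imp_continuous_on)+
  have ne: "?K \<noteq> {}" using d by auto
  obtain u where u: "u \<in> ?K" "\<And>y. y \<in> ?K \<Longrightarrow> norm (f y) \<le> norm (f u)"
    using continuous_attains_sup[OF compact_cball ne continuous_on_norm[OF cf]] by blast
  obtain v where v: "v \<in> ?K" "\<And>y. y \<in> ?K \<Longrightarrow> norm (g y) \<le> norm (g v)"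
    using continuous_attains_sup[OF compact_cball ne continuous_on_norm[OF cg]] by blast
  have gv: "norm (g v) < 1"
    using v d assms(4) by blast
  have "uniformly_convergent_on ?K (\<lambda>N q. \<Prod>k<N. 1 - f q * g q ^ k)"
  proof (rule uniformly_convergent_on_prod')
    show "uniformly_convergent_on ?K (\<lambda>N q. \<Sum>k<N. norm (1 - f q * g q ^ k - 1))"
    proof (rule Weierstrass_m_test')
      fix k q assume q: "q \<in> ?K"
      show "norm (norm (1 - f q * g q ^ k - 1)) \<le> norm (f u) * norm (g v) ^ k"
        using u(2)[OF q] v(2)[OF q] by (simp add: norm_mult norm_power mult_mono power_mono)
    next
      show "summable (\<lambda>k. norm (f u) * norm (g v) ^ k)"
        using gv by (intro summable_mult summable_geometric) auto
    qed
  qed (use cf cg in \<open>auto intro!: continuous_intros\<close>)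
  then obtain l where l: "uniform_limit ?K (\<lambda>N q. \<Prod>k<N. 1 - f q * g q ^ k) l sequentially"
    by (auto simp: uniformly_convergent_on_def)
  also have "?this \<longleftrightarrow>
      uniform_limit ?K (\<lambda>N q. \<Prod>k<N. 1 - f q * g q ^ k) (\<lambda>q. qp (f q) (g q)) sequentially"
  proof (intro uniform_limit_cong)
    fix y assume y: "y \<in> ?K"
    have "(\<lambda>N. \<Prod>k<N. 1 - f y * g y ^ k) \<longlonglongrightarrow> l y"
      using tendsto_uniform_limitI[OF l y] .
    moreover have "(\<lambda>N. \<Prod>k<N. 1 - f y * g y ^ k) \<longlonglongrightarrow> qp (f y) (g y)"
      using y d assms(4) by (intro qp_tendsto) auto
    ultimately show "l y = qp (f y) (g y)"
      by (rule LIMSEQ_unique)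
  qed auto
  finally show "\<exists>d>0. cball x d \<subseteq> S \<and>
      uniform_limit (cball x d) (\<lambda>N q. \<Prod>k<N. 1 - f q * g q ^ k) (\<lambda>q. qp (f q) (g q)) sequentially"
    using d by blast
qed

section \<open>Unconditional sums over the integers and dominated convergence\<close>

lemma summable_on_int:
  fixes f :: "int \<Rightarrow> real"
  assumes "summable (\<lambda>n. f (int n))" "summable (\<lambda>n. f (- int n))" "\<And>n. f n \<ge> 0"
  shows "f summable_on UNIV"
proof -
  have 1: "(\<lambda>n. f (int n)) summable_on UNIV" "(\<lambda>n. f (- int n)) summable_on UNIV"
    using assms by (auto simp: summable_on_UNIV_nonneg_real_iff)
  have "f summable_on range int"
    using summable_on_reindex[of int UNIV f] 1 by (simp add: o_def)
  moreover have "f summable_on range (\<lambda>n. - int n)"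
    using summable_on_reindex[of "\<lambda>n. - int n" UNIV f] 1 by (simp add: o_def inj_on_def)
  ultimately have "f summable_on (range int \<union> range (\<lambda>n. - int n))"
    by (rule summable_on_union)
  also have "range int \<union> range (\<lambda>n. - int n) = UNIV"
    by (auto simp: image_def) (metis int_cases2)
  finally show ?thesis .
qed

text \<open>The term is \<open>(x * r ^ n) ^ n\<close>, and \<open>x * r ^ n\<close> tends to 0
  however large \<open>x\<close> is, so a geometric series of ratio 1/2 eventually
  dominates.\<close>

lemma summable_power_square:
  fixes x r :: real
  assumes "0 \<le> x" "0 \<le> r" "r < 1"
  shows "summable (\<lambda>n. x ^ n * r ^ (n ^ 2))"
proof -
  have "(\<lambda>n. x * r ^ n) \<longlonglongrightarrow> x * 0"
    using assms by (intro tendsto_mult tendsto_const LIMSEQ_realpow_zero) auto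
  then have "eventually (\<lambda>n. x * r ^ n < 1 / 2) sequentially"
    by (intro order_tendstoD) auto
  then have "eventually (\<lambda>n. norm (x ^ n * r ^ (n ^ 2)) \<le> (1 / 2) ^ n) sequentially"
  proof eventually_elim
    case (elim n)
    have "x ^ n * r ^ (n ^ 2) = (x * r ^ n) ^ n"
      by (simp add: power_mult_distrib power2_eq_square power_mult)
    also have "\<dots> \<le> (1 / 2) ^ n"
      using elim assms by (intro power_mono) auto
    finally show ?case using assms by simp
  qed
  then show ?thesis
    by (rule summable_comparison_test_ev) (auto intro: summable_geometric)
qed

lemma abs_summable_theta:
  fixes x Q :: complex
  assumes "norm Q < 1"
  shows "(\<lambda>n::int. norm (x powi n * Q powi (n ^ 2))) summable_on UNIV"
proof (rule summable_on_int)
  have *: "Q powi (int n ^ 2) = Q ^ (n ^ 2)" for n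
    by (metis of_nat_power power_int_of_nat)
  show "summable (\<lambda>n. norm (x powi int n * Q powi (int n ^ 2)))"
    using summable_power_square[of "norm x" "norm Q"] assms
    by (simp add: norm_mult norm_power * )
  show "summable (\<lambda>n. norm (x powi (- int n) * Q powi ((- int n) ^ 2)))"
    using summable_power_square[of "inverse (norm x)" "norm Q"] assms
    by (simp add: norm_mult norm_power * power_int_minus norm_inverse power_inverse)
qed auto

text \<open>Tannery's theorem for series over the naturals, transported along the bijection
  \<open>int_decode\<close>.\<close>

lemma tannery_int:
  fixes a :: "int \<Rightarrow> nat \<Rightarrow> complex"
  assumes lim: "\<And>k. (\<lambda>n. a k n) \<longlonglongrightarrow> b k"
    and bound: "\<And>k n. norm (a k n) \<le> M k"
    and M: "M summable_on UNIV"
    and sum: "\<And>n. ((\<lambda>k. a k n) has_sum s n) UNIV"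
    and s: "s \<longlonglongrightarrow> s'"
  shows "(b has_sum s') UNIV"
proof -
  have bij: "bij_betw int_decode UNIV UNIV"
    by (simp add: bij_int_decode)
  have "(\<lambda>k. M (int_decode k)) summable_on UNIV"
    using M summable_on_reindex_bij_betw[OF bij, of M] by simp
  then have M': "summable (\<lambda>k. M (int_decode k))"
    by (rule summable_on_imp_summable)
  have sum': "(\<lambda>k. a (int_decode k) n) sums s n" for n
    using sum has_sum_reindex_bij_betw[OF bij, of "\<lambda>k. a k n"] has_sum_imp_sums by blast
  have T: "summable (\<lambda>k. norm (b (int_decode k)))"
    "(\<lambda>n. suminf (\<lambda>k. a (int_decode k) n)) \<longlonglongrightarrow> suminf (\<lambda>k. b (int_decode k))"
    using tannerys_theorem[of "\<lambda>k n. a (int_decode k) n" "\<lambda>k. b (int_decode k)" sequentially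
        "\<lambda>k. M (int_decode k)"] lim bound M' by (auto simp: case_prod_unfold)
  have "(\<lambda>n. suminf (\<lambda>k. a (int_decode k) n)) = s"
    using sum' by (auto simp: sums_iff)
  with T(2) s have "suminf (\<lambda>k. b (int_decode k)) = s'"
    using LIMSEQ_unique by auto
  moreover have "((\<lambda>k. b (int_decode k)) has_sum suminf (\<lambda>k. b (int_decode k))) UNIV"
    using T(1) by (intro norm_summable_imp_has_sum) (auto intro: summable_norm_cancel)
  ultimately show ?thesis
    using has_sum_reindex_bij_betw[OF bij, of b] by simp
qed

section \<open>The triple product: finite form by induction, then the limit\<close>

definition qfac :: "complex \<Rightarrow> nat \<Rightarrow> complex" where
  "qfac B n = (\<Prod>k<n. 1 - B * B ^ k)"

text \<open>Like a reciprocal Gamma function, the reciprocal q-factorial is continued by 0 to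
  negative arguments. Thus the q-binomial coefficients below vanish out of range and finite sums can
  be written over all integers.\<close>

definition rqfac :: "complex \<Rightarrow> int \<Rightarrow> complex" where
  "rqfac B n = (if n < 0 then 0 else inverse (qfac B (nat n)))"

lemma qfac_Suc: "qfac B (Suc n) = (1 - B ^ Suc n) * qfac B n"
  by (simp add: qfac_def)

lemma qfac_nonzero:
  assumes "norm B < 1"
  shows "qfac B n \<noteq> 0"
proof (induction n)
  case (Suc n)
  have "norm (B ^ Suc n) < 1"
    unfolding norm_power using assms power_less_one_iff[of "norm B" "Suc n"] by auto
  then have "B ^ Suc n \<noteq> 1" by (auto simp del: power_Suc)
  then show ?case using Suc by (simp add: qfac_Suc del: power_Suc)
qed (simp add: qfac_def)

text \<open>The recurrence survives the continuation by 0: at \<open>n = 0\<close> the factor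
  \<open>1 - B powi 0\<close> vanishes.\<close>

lemma rqfac_diff_one:
  assumes "norm B < 1" "B \<noteq> 0"
  shows "rqfac B (n - 1) = (1 - B powi n) * rqfac B n"
proof -
  consider "n < 0" | "n = 0" | m where "n = int (Suc m)"
  proof -
    have "n > 0 \<Longrightarrow> n = int (Suc (nat n - 1))" by auto
    then show ?thesis using that by (meson linorder_neqE_linordered_idom)
  qed
  then show ?thesis
  proof cases
    case (3 m)
    have "nat n = Suc m" "nat (n - 1) = m" "n \<ge> 0" "n - 1 \<ge> 0" using 3 by auto
    moreover have "B powi n = B ^ Suc m" using 3 power_int_of_nat by blast
    moreover have "1 - B ^ Suc m \<noteq> 0"
      using qfac_nonzero[OF assms(1), of "Suc m"] by (auto simp: qfac_Suc)
    ultimately show ?thesis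
      by (simp add: rqfac_def qfac_Suc del: power_Suc)
  qed (auto simp: rqfac_def)
qed

text \<open>The coefficient is the Gaussian binomial of \<open>2 * N\<close> over
  \<open>N + j\<close> to the base \<open>Q ^ 2\<close>. The induction step is a q-Pascal rule,
  applied twice at once.\<close>

lemma jacobi_triple_product_finite:
  fixes Q x :: complex
  assumes Q: "norm Q < 1" "Q \<noteq> 0" and x: "x \<noteq> 0"
  shows "((\<lambda>j. qfac (Q ^ 2) (2 * N) * rqfac (Q ^ 2) (int N + j) * rqfac (Q ^ 2) (int N - j)
            * (x powi j * Q powi (j ^ 2)))
          has_sum (\<Prod>k<N. (1 + x * Q * (Q ^ 2) ^ k) * (1 + Q / x * (Q ^ 2) ^ k))) UNIV"
proof (induction N)
  case 0
  have "((\<lambda>j. if j = 0 then 1 else 0) has_sum (1::complex)) (UNIV::int set)"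
    by (rule has_sum_finite_neutralI[of "{0}"]) auto
  moreover have "(\<lambda>j. qfac (Q ^ 2) (2 * 0) * rqfac (Q ^ 2) (int 0 + j) * rqfac (Q ^ 2) (int 0 - j)
            * (x powi j * Q powi (j ^ 2))) = (\<lambda>j. if j = 0 then 1 else 0)"
    by (auto simp: rqfac_def qfac_def)
  ultimately show ?case by simp
next
  case (Suc N)
  define B where "B = Q ^ 2"
  have B: "norm B < 1" "B \<noteq> 0"
    using Q by (auto simp: B_def norm_power power_less_one_iff)
  define f where "f N j = qfac B (2 * N) * rqfac B (int N + j) * rqfac B (int N - j)
            * (x powi j * Q powi (j ^ 2))" for N j
  define F where "F = (\<Prod>k<N. (1 + x * Q * B ^ k) * (1 + Q / x * B ^ k))"
  define c where "c = Q ^ (2 * N + 1)"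
  have IH: "(f N has_sum F) UNIV"
    using Suc unfolding f_def F_def B_def .
  have s1: "((\<lambda>j. f N (j - 1)) has_sum F) UNIV"
    using IH has_sum_reindex_bij_witness[of UNIV "\<lambda>j. j + 1" "\<lambda>j. j - 1" UNIV "f N" "\<lambda>j. f N (j - 1)" F F]
    by simp
  have s2: "((\<lambda>j. f N (j + 1)) has_sum F) UNIV"
    using IH has_sum_reindex_bij_witness[of UNIV "\<lambda>j. j - 1" "\<lambda>j. j + 1" UNIV "f N" "\<lambda>j. f N (j + 1)" F F]
    by simp
  \<comment> \<open>The new factor is
    \<open>(1 + x * c) * (1 + c / x) = 1 + c ^ 2 + c * x + c / x\<close>; its last two terms shift
    the summation index by one in either direction.\<close>
  have "((\<lambda>j. (1 + c ^ 2) * f N j + (c * x * f N (j - 1) + c / x * f N (j + 1))) has_sum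
          ((1 + c ^ 2) * F + (c * x * F + c / x * F))) UNIV"
    by (intro has_sum_add has_sum_cmult_right IH s1 s2)
  also have "(1 + c ^ 2) * F + (c * x * F + c / x * F) = F * ((1 + x * c) * (1 + c / x))"
    using x by (simp add: field_simps power2_eq_square)
  also have "\<dots> = (\<Prod>k<Suc N. (1 + x * Q * B ^ k) * (1 + Q / x * B ^ k))"
  proof -
    have "c = Q * B ^ N"
      by (simp add: c_def B_def power_mult)
    then show ?thesis by (simp add: F_def mult_ac)
  qed
  also have "(\<lambda>j. (1 + c ^ 2) * f N j + (c * x * f N (j - 1) + c / x * f N (j + 1))) = f (Suc N)"
  proof
    fix j
    \<comment> \<open>All terms become rational in \<open>a\<close>, \<open>b\<close>,
      \<open>B\<close>, with common factor \<open>p * u * v * y\<close>. What remains is \<open>(1 +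
      a b / B) (1 - a) (1 - b) + (1 - a / B) (1 - a) b + (1 - b / B) (1 - b) a = (1 - a b) (1 - a b
      / B)\<close>.\<close>
    define a b where "a = B powi (int N + 1 + j)" and "b = B powi (int N + 1 - j)"
    define u v where "u = rqfac B (int N + 1 + j)" and "v = rqfac B (int N + 1 - j)"
    define y where "y = x powi j * Q powi (j ^ 2)"
    have nz: "a \<noteq> 0" "b \<noteq> 0" using B by (auto simp: a_def b_def)
    have u1: "rqfac B (int N + j) = (1 - a) * u"
    proof -
      have e: "int N + j = int N + 1 + j - 1" by simp
      show ?thesis unfolding e rqfac_diff_one[OF B] a_def u_def by simp
    qed
    have v1: "rqfac B (int N - j) = (1 - b) * v"
    proof -
      have e: "int N - j = int N + 1 - j - 1" by simp
      show ?thesis unfolding e rqfac_diff_one[OF B] b_def v_def by simp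
    qed
    have aB: "B powi (int N + j) = a / B" "B powi (int N - j) = b / B"
      using B power_int_diff[of B "int N + 1 + j" 1] power_int_diff[of B "int N + 1 - j" 1]
      by (auto simp: a_def b_def algebra_simps)
    have u2: "rqfac B (int N + (j - 1)) = (1 - a / B) * ((1 - a) * u)"
    proof -
      have e: "int N + (j - 1) = int N + j - 1" by simp
      show ?thesis unfolding e rqfac_diff_one[OF B] aB u1 ..
    qed
    have v2: "rqfac B (int N - (j + 1)) = (1 - b / B) * ((1 - b) * v)"
    proof -
      have e: "int N - (j + 1) = int N - j - 1" by simp
      show ?thesis unfolding e rqfac_diff_one[OF B] aB v1 ..
    qed
    have u3: "rqfac B (int N + (j + 1)) = u" "rqfac B (int N - (j - 1)) = v"
      by (auto simp: u_def v_def algebra_simps)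
    have ab: "a * b = B ^ (2 * N + 2)"
    proof -
      have "a * b = B powi (int N + 1 + j + (int N + 1 - j))"
        unfolding a_def b_def using B by (subst power_int_add) auto
      also have "int N + 1 + j + (int N + 1 - j) = int (2 * N + 2)" by simp
      finally show ?thesis by (simp only: power_int_of_nat)
    qed
    have c2: "c ^ 2 = a * b / B"
      using B by (simp add: ab c_def B_def field_simps flip: power_mult power_add)
    have cy1: "c * x * (x powi (j - 1) * Q powi ((j - 1) ^ 2)) = b * y"
    proof -
      have "c * Q powi ((j - 1) ^ 2) = Q powi (int (2 * N + 1) + (j - 1) ^ 2)"
        using Q by (subst power_int_add) (auto simp only: c_def power_int_of_nat)
      also have "int (2 * N + 1) + (j - 1) ^ 2 = 2 * (int N + 1 - j) + j ^ 2"
        by (simp add: power2_eq_square algebra_simps)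
      also have "Q powi \<dots> = b * Q powi (j ^ 2)"
        using Q by (subst power_int_add) (auto simp: b_def B_def power_int_power algebra_simps)
      finally have *: "c * Q powi ((j - 1) ^ 2) = b * Q powi (j ^ 2)" .
      have "x * x powi (j - 1) = x powi j"
        using x by (simp add: power_int_diff)
      moreover have "c * x * (x powi (j - 1) * Q powi ((j - 1) ^ 2)) =
          (x * x powi (j - 1)) * (c * Q powi ((j - 1) ^ 2))"
        by (simp only: mult_ac)
      ultimately show ?thesis using * unfolding y_def by simp
    qed
    have cy2: "c / x * (x powi (j + 1) * Q powi ((j + 1) ^ 2)) = a * y"
    proof -
      have "c * Q powi ((j + 1) ^ 2) = Q powi (int (2 * N + 1) + (j + 1) ^ 2)"
        using Q by (subst power_int_add) (auto simp only: c_def power_int_of_nat)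
      also have "int (2 * N + 1) + (j + 1) ^ 2 = 2 * (int N + 1 + j) + j ^ 2"
        by (simp add: power2_eq_square algebra_simps)
      also have "Q powi \<dots> = a * Q powi (j ^ 2)"
        using Q by (subst power_int_add) (auto simp: a_def B_def power_int_power algebra_simps)
      finally have *: "c * Q powi ((j + 1) ^ 2) = a * Q powi (j ^ 2)" .
      have "x powi (j + 1) = x * x powi j"
        using x by (simp add: power_int_add)
      then show ?thesis using * x unfolding y_def by (simp add: field_simps)
    qed
    define p where "p = qfac B (2 * N)"
    have p: "qfac B (2 * Suc N) = (1 - a * b) * (1 - a * b / B) * p"
      using B unfolding ab by (simp add: qfac_Suc p_def)
    have "c * x * f N (j - 1) = p * u * v * (1 - a / B) * (1 - a) *
        (c * x * (x powi (j - 1) * Q powi ((j - 1) ^ 2)))"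
      unfolding f_def u2 u3 p_def by (simp add: mult_ac)
    then have t1: "c * x * f N (j - 1) = p * u * v * (1 - a / B) * (1 - a) * (b * y)"
      unfolding cy1 .
    have "c / x * f N (j + 1) = p * u * v * (1 - b / B) * (1 - b) *
        (c / x * (x powi (j + 1) * Q powi ((j + 1) ^ 2)))"
      unfolding f_def v2 u3 p_def by (simp add: mult_ac)
    then have t2: "c / x * f N (j + 1) = p * u * v * (1 - b / B) * (1 - b) * (a * y)"
      unfolding cy2 .
    have t3: "(1 + c ^ 2) * f N j = (1 + a * b / B) * (p * ((1 - a) * u) * ((1 - b) * v) * y)"
      unfolding f_def u1 v1 c2 p_def y_def ..
    have t4: "f (Suc N) j = (1 - a * b) * (1 - a * b / B) * p * u * v * y"
      unfolding f_def p y_def u_def v_def by (simp add: algebra_simps)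
    show "(1 + c ^ 2) * f N j + (c * x * f N (j - 1) + c / x * f N (j + 1)) = f (Suc N) j"
      unfolding t1 t2 t3 t4 using B by (simp add: field_simps)
  qed
  finally show ?case
    unfolding f_def B_def .
qed

text \<open>As \<open>N\<close> grows, each Gaussian binomial tends to \<open>1 / P\<close>.
  Convergent sequences are bounded, so \<open>C * D * D\<close> bounds the coefficients and the
  theta series itself is the majorant.\<close>

theorem jacobi_triple_product:
  fixes Q x :: complex
  assumes Q: "norm Q < 1" "Q \<noteq> 0" and x: "x \<noteq> 0"
  shows "((\<lambda>j. x powi j * Q powi (j ^ 2)) has_sum
          (qp (Q ^ 2) (Q ^ 2) * qp (- (x * Q)) (Q ^ 2) * qp (- (Q / x)) (Q ^ 2))) UNIV"
proof -
  define B where "B = Q ^ 2"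
  have B: "norm B < 1" "B \<noteq> 0"
    using Q by (auto simp: B_def norm_power power_less_one_iff)
  define P where "P = qp B B"
  have P: "P \<noteq> 0" unfolding P_def using B by (intro qp_nonzero) auto
  have q_lim: "qfac B \<longlonglongrightarrow> P"
    unfolding P_def qfac_def using qp_tendsto[OF B(1), of B] by simp
  then obtain C where C: "C > 0" "\<And>n. norm (qfac B n) \<le> C"
    by (meson Bseq_def convergentI convergent_imp_Bseq)
  have inv_lim: "(\<lambda>n. inverse (qfac B n)) \<longlonglongrightarrow> inverse P"
    using q_lim P by (rule tendsto_inverse)
  then obtain D where D: "D > 0" "\<And>n. norm (inverse (qfac B n)) \<le> D"
    by (meson Bseq_def convergentI convergent_imp_Bseq)
  have rD: "norm (rqfac B n) \<le> D" for n
    using D by (simp add: rqfac_def less_imp_le)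
  have r_lim: "(\<lambda>N. rqfac B (int N + j)) \<longlonglongrightarrow> inverse P" for j
  proof (rule Lim_transform_eventually)
    have "filterlim (\<lambda>N. nat (int N + j)) sequentially sequentially"
      unfolding filterlim_at_top eventually_sequentially
    proof
      fix Z show "\<exists>N. \<forall>n\<ge>N. Z \<le> nat (int n + j)"
        by (rule exI[of _ "Z + nat \<bar>j\<bar>"]) auto
    qed
    then show "(\<lambda>N. inverse (qfac B (nat (int N + j)))) \<longlonglongrightarrow> inverse P"
      by (rule filterlim_compose[OF inv_lim])
    show "eventually (\<lambda>N. inverse (qfac B (nat (int N + j))) = rqfac B (int N + j)) sequentially"
      unfolding eventually_sequentially
      by (rule exI[of _ "nat \<bar>j\<bar>"]) (auto simp: rqfac_def)
  qed
  have r_lim': "(\<lambda>N. rqfac B (int N - j)) \<longlonglongrightarrow> inverse P" for j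
    using r_lim[of "- j"] by simp
  let ?y = "\<lambda>j. x powi j * Q powi (j ^ 2)"
  define a where "a j N = qfac B (2 * N) * rqfac B (int N + j) * rqfac B (int N - j) * ?y j" for j N
  have 1: "(\<lambda>N. a j N) \<longlonglongrightarrow> P * inverse P * inverse P * ?y j" for j
    unfolding a_def
    by (intro tendsto_mult r_lim r_lim' tendsto_const filterlim_compose[OF q_lim])
       (auto intro: mult_nat_left_at_top)
  have 2: "norm (a j N) \<le> C * D * D * norm (?y j)" for j N
    unfolding a_def norm_mult using C D rD by (intro mult_mono mult_nonneg_nonneg) (auto intro: less_imp_le)
  have 3: "(\<lambda>j. C * D * D * norm (?y j)) summable_on UNIV"
    by (intro summable_on_cmult_right abs_summable_theta Q)
  have 4: "((\<lambda>j. a j N) has_sum (\<Prod>k<N. (1 + x * Q * B ^ k) * (1 + Q / x * B ^ k))) UNIV" for N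
    using jacobi_triple_product_finite[OF Q x, of N] unfolding a_def B_def .
  have 5: "(\<lambda>N. \<Prod>k<N. (1 + x * Q * B ^ k) * (1 + Q / x * B ^ k)) \<longlonglongrightarrow>
      qp (- (x * Q)) B * qp (- (Q / x)) B"
    using tendsto_mult[OF qp_tendsto[OF B(1), of "- (x * Q)"] qp_tendsto[OF B(1), of "- (Q / x)"]]
    unfolding prod.distrib by simp
  have "((\<lambda>j. P * inverse P * inverse P * ?y j) has_sum qp (- (x * Q)) B * qp (- (Q / x)) B) UNIV"
    by (rule tannery_int[OF 1 2 3 4 5])
  then have "((\<lambda>j. P * (P * inverse P * inverse P * ?y j)) has_sum
      P * (qp (- (x * Q)) B * qp (- (Q / x)) B)) UNIV"
    by (rule has_sum_cmult_right)
  moreover have "(\<lambda>j. P * (P * inverse P * inverse P * ?y j)) = ?y"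
    using P by (auto simp: field_simps)
  ultimately show ?thesis
    unfolding P_def B_def by (simp add: mult.assoc)
qed

section \<open>Theta functions\<close>

lemma has_sum_times:
  fixes f :: "'a \<Rightarrow> complex" and g :: "'b \<Rightarrow> complex"
  assumes f: "(f has_sum a) UNIV" and g: "(g has_sum b) UNIV"
  shows "((\<lambda>(m, n). f m * g n) has_sum (a * b)) UNIV"
proof -
  have f': "(\<lambda>m. norm (f m)) summable_on UNIV" and g': "(\<lambda>n. norm (g n)) summable_on UNIV"
    using f g summable_on_iff_abs_summable_on_complex has_sum_imp_summable by blast+
  have "(\<lambda>x. norm (case x of (m, n) \<Rightarrow> f m * g n)) summable_on (UNIV \<times> UNIV)"
  proof (rule summable_on_SigmaI)
    fix m
    show "((\<lambda>n. norm (case (m, n) of (m, n) \<Rightarrow> f m * g n)) has_sum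
            norm (f m) * infsum (\<lambda>n. norm (g n)) UNIV) UNIV"
      using has_sum_cmult_right[OF has_sum_infsum[OF g'], of "norm (f m)"] by (simp add: norm_mult)
  next
    show "(\<lambda>m. norm (f m) * infsum (\<lambda>n. norm (g n)) UNIV) summable_on UNIV"
      by (intro summable_on_cmult_left f')
  qed auto
  then have s: "(\<lambda>(m, n). f m * g n) summable_on (UNIV \<times> UNIV)"
    by (rule abs_summable_summable)
  have "((\<lambda>(m, n). f m * g n) has_sum (a * b)) (UNIV \<times> UNIV)"
  proof (rule has_sum_SigmaI[OF _ _ s])
    show "((\<lambda>n. case (m, n) of (m, n) \<Rightarrow> f m * g n) has_sum f m * b) UNIV" for m
      using has_sum_cmult_right[OF g] by simp
    show "((\<lambda>m. f m * b) has_sum a * b) UNIV"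
      by (rule has_sum_cmult_left[OF f])
  qed
  then show ?thesis by simp
qed

text \<open>For the shifted Gaussian integer \<open>(m + e/2) + (n + e/2) i\<close>, the map to
  \<open>(- n - e, m)\<close> is multiplication by \<open>i\<close>. Modulo \<open>2 + i\<close> one
  has \<open>i = - 2\<close> and \<open>- 1/2 = 2\<close>, so \<open>m - 2 * n + 2 * e\<close> is
  its residue, and rotation multiplies the residue by \<open>- 2\<close>.\<close>

lemma infsum_gauss_rotation:
  fixes F :: "int \<times> int \<Rightarrow> complex"
  assumes "\<And>m n. F (- n - e, m) = F (m, n)" and r: "r \<in> {0..<5}"
  shows "infsum F {(m, n). (m - 2 * n + 2 * e) mod 5 = r} =
         infsum F {(m, n). (m - 2 * n + 2 * e) mod 5 = (-2 * r) mod 5}"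
proof (rule infsum_reindex_bij_witness[of _ "\<lambda>(m, n). (n, - m - e)" "\<lambda>(m, n). (- n - e, m)"])
  fix p assume "p \<in> {(m, n). (m - 2 * n + 2 * e) mod 5 = r}"
  then obtain m n where p: "p = (m, n)" "(m - 2 * n + 2 * e) mod 5 = r" by auto
  define k where "k = (m - 2 * n + 2 * e) div 5"
  have "m = 2 * n - 2 * e + 5 * k + r"
    using p(2) div_mult_mod_eq[of "m - 2 * n + 2 * e" 5] by (simp add: k_def)
  then have "(- n - e) - 2 * m + 2 * e = - 2 * r + (- n + e - 2 * k) * 5"
    by (simp add: algebra_simps)
  then have "((- n - e) - 2 * m + 2 * e) mod 5 = (-2 * r) mod 5"
    by (metis mod_mult_self1)
  then show "(\<lambda>(m, n). (- n - e, m)) p \<in> {(m, n). (m - 2 * n + 2 * e) mod 5 = (-2 * r) mod 5}"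
    by (simp add: p)
next
  fix p assume "p \<in> {(m, n). (m - 2 * n + 2 * e) mod 5 = (-2 * r) mod 5}"
  then obtain m n where p: "p = (m, n)" "(m - 2 * n + 2 * e) mod 5 = (-2 * r) mod 5" by auto
  then have "5 dvd (m - 2 * n + 2 * e) - (-2 * r)"
    using mod_eq_dvd_iff by blast
  then obtain k where "(m - 2 * n + 2 * e) - (-2 * r) = 5 * k" ..
  then have "n - 2 * (- m - e) + 2 * e = r + (n + 2 * k - r) * 5"
    by simp
  then have "(n - 2 * (- m - e) + 2 * e) mod 5 = r mod 5"
    by (metis mod_mult_self1)
  then show "(\<lambda>(m, n). (n, - m - e)) p \<in> {(m, n). (m - 2 * n + 2 * e) mod 5 = r}"
    using r by (simp add: p)
qed (use assms in auto)

text \<open>Modulo \<open>2 + i\<close> the residues of the Gaussian integers are \<open>0\<close> and the four units, and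
  multiplication by \<open>i\<close> permutes the nonzero residue classes cyclically. The parameter \<open>e\<close>
  shifts the lattice by \<open>(e / 2, e / 2)\<close>.\<close>

lemma infsum_gauss_cosets:
  fixes F :: "int \<times> int \<Rightarrow> complex"
  assumes F: "F summable_on UNIV" and inv: "\<And>m n. F (- n - e, m) = F (m, n)"
  shows "infsum F UNIV = infsum (\<lambda>(a, b). F (2 * a - b, a + 2 * b + e)) UNIV
                        + 4 * infsum (\<lambda>(a, b). F (2 * a - b + 1, a + 2 * b + e)) UNIV"
proof -
  define S :: "int \<Rightarrow> (int \<times> int) set" where "S r = {(m, n). (m - 2 * n + 2 * e) mod 5 = r}" for r
  have cover: "(\<Union>r\<in>{0..<5}. S r) = UNIV"
    by (auto simp: S_def)
  have "(F has_sum (\<Sum>r\<in>{0..<5}. infsum F (S r))) (\<Union>r\<in>{0..<5}. S r)"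
    by (intro sum_has_sum has_sum_infsum summable_on_subset[OF F]) (auto simp: S_def)
  then have "infsum F UNIV = (\<Sum>r\<in>{0..<5}. infsum F (S r))"
    unfolding cover by (rule infsumI)
  also have "{0..<5::int} = {0, 1, 2, 3, 4}" by auto
  also have "(\<Sum>r\<in>\<dots>. infsum F (S r)) =
      infsum F (S 0) + infsum F (S 1) + infsum F (S 2) + infsum F (S 3) + infsum F (S 4)"
    by (simp add: add_ac)
  \<comment> \<open>Multiplication by \<open>- 2\<close> runs through the nonzero residues as 1, 3,
    4, 2, 1.\<close>
  also have "infsum F (S 2) = infsum F (S 1)"
    using infsum_gauss_rotation[of F e 2, OF inv] by (simp add: S_def)
  also have "infsum F (S 4) = infsum F (S 1)"
    using infsum_gauss_rotation[of F e 2, OF inv] infsum_gauss_rotation[of F e 4, OF inv]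
    by (simp add: S_def)
  also have "infsum F (S 3) = infsum F (S 1)"
    using infsum_gauss_rotation[of F e 1, OF inv] by (simp add: S_def)
  \<comment> \<open>\<open>S 0\<close> consists of the multiples \<open>(2 + i) w\<close> with
    \<open>w\<close> in the same shifted lattice; the witness below is the quotient
    \<open>w\<close>.\<close>
  also have "infsum F (S 0) = infsum (\<lambda>(a, b). F (2 * a - b, a + 2 * b + e)) UNIV"
  proof -
    have "p \<in> range (\<lambda>(a, b). (2 * a - b, a + 2 * b + e))" if "p \<in> S 0" for p
    proof -
      obtain m n where p: "p = (m, n)" "5 dvd m - 2 * n + 2 * e"
        using \<open>p \<in> S 0\<close> by (auto simp: S_def dvd_eq_mod_eq_0)
      then obtain k where "m - 2 * n + 2 * e = 5 * k" by blast
      then show ?thesis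
        by (intro image_eqI[of _ _ "(n - e + 2 * k, - k)"]) (auto simp: p)
    qed
    then have "S 0 = range (\<lambda>(a, b). (2 * a - b, a + 2 * b + e))"
      by (auto simp: S_def)
    moreover have "inj (\<lambda>(a, b). (2 * a - b, a + 2 * b + e))"
      by (auto simp: inj_def)
    ultimately show ?thesis
      by (simp add: infsum_reindex o_def case_prod_unfold)
  qed
  also have "infsum F (S 1) = infsum (\<lambda>(a, b). F (2 * a - b + 1, a + 2 * b + e)) UNIV"
  proof -
    have "p \<in> range (\<lambda>(a, b). (2 * a - b + 1, a + 2 * b + e))" if "p \<in> S 1" for p
    proof -
      obtain m n where p: "p = (m, n)" "(m - 2 * n + 2 * e) mod 5 = 1 mod 5"
        using \<open>p \<in> S 1\<close> by (auto simp: S_def)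
      then obtain k where "m - 2 * n + 2 * e - 1 = 5 * k"
        unfolding mod_eq_dvd_iff by blast
      then show ?thesis
        by (intro image_eqI[of _ _ "(n - e + 2 * k, - k)"]) (auto simp: p)
    qed
    moreover have "(2 * a - b + 1, a + 2 * b + e) \<in> S 1" for a b
    proof -
      have "(2 * a - b + 1) - 2 * (a + 2 * b + e) + 2 * e = 1 + (- b) * 5" by simp
      then show ?thesis
        unfolding S_def by (simp only: mem_Collect_eq case_prod_conv mod_mult_self1) simp
    qed
    ultimately have "S 1 = range (\<lambda>(a, b). (2 * a - b + 1, a + 2 * b + e))"
      by auto
    moreover have "inj (\<lambda>(a, b). (2 * a - b + 1, a + 2 * b + e))"
      by (auto simp: inj_def)
    ultimately show ?thesis
      by (simp add: infsum_reindex o_def case_prod_unfold)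
  qed
  finally show ?thesis by simp
qed

text \<open>The analogous splitting modulo \<open>1 + i\<close>, where the residue is the parity of
  \<open>m + n\<close>.\<close>

lemma infsum_parity_cosets:
  fixes F :: "int \<times> int \<Rightarrow> complex"
  assumes F: "F summable_on UNIV"
  shows "infsum F UNIV = infsum (\<lambda>(a, b). F (a + b, a - b)) UNIV
                        + infsum (\<lambda>(a, b). F (a + b + 1, a - b)) UNIV"
proof -
  define S :: "(int \<times> int) set" where "S = {(m, n). even (m + n)}"
  have "infsum F UNIV = infsum F (S \<union> - S)" by simp
  also have "\<dots> = infsum F S + infsum F (- S)"
    by (intro infsum_Un_disjoint summable_on_subset[OF F]) auto
  also have "infsum F S = infsum (\<lambda>(a, b). F (a + b, a - b)) UNIV"
  proof -
    have "p \<in> range (\<lambda>(a, b). (a + b, a - b))" if "p \<in> S" for p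
    proof -
      obtain m n where p: "p = (m, n)" "2 dvd m + n"
        using \<open>p \<in> S\<close> by (auto simp: S_def)
      then obtain k where "m + n = 2 * k" by blast
      then show ?thesis
        by (intro image_eqI[of _ _ "(k, m - k)"]) (auto simp: p)
    qed
    then have "S = range (\<lambda>(a, b). (a + b, a - b))"
      by (auto simp: S_def)
    moreover have "inj (\<lambda>(a, b). (a + b, a - b :: int))"
      by (auto simp: inj_def)
    ultimately show ?thesis
      by (simp add: infsum_reindex o_def case_prod_unfold)
  qed
  also have "infsum F (- S) = infsum (\<lambda>(a, b). F (a + b + 1, a - b)) UNIV"
  proof -
    have "p \<in> range (\<lambda>(a, b). (a + b + 1, a - b))" if "p \<notin> S" for p
    proof -
      obtain m n where p: "p = (m, n)" "odd (m + n)"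
        using \<open>p \<notin> S\<close> by (cases p) (auto simp: S_def)
      then obtain k where "m + n = 2 * k + 1" by (elim oddE)
      then show ?thesis
        by (intro image_eqI[of _ _ "(k, m - k - 1)"]) (auto simp: p)
    qed
    then have "- S = range (\<lambda>(a, b). (a + b + 1, a - b))"
      by (auto simp: S_def)
    moreover have "inj (\<lambda>(a, b). (a + b + 1, a - b :: int))"
      by (auto simp: inj_def)
    ultimately show ?thesis
      by (simp add: infsum_reindex o_def case_prod_unfold)
  qed
  finally show ?thesis .
qed

section \<open>Theta functions as products and their duplication formulas\<close>

definition euler2 :: "complex \<Rightarrow> complex" where "euler2 q = qp (q ^ 2) (q ^ 2)"
definition p2 :: "complex \<Rightarrow> complex" where "p2 q = qp (- (q ^ 2)) (q ^ 2)"
definition p3 :: "complex \<Rightarrow> complex" where "p3 q = qp (- q) (q ^ 2)"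
definition phi :: "complex \<Rightarrow> complex" where "phi q = euler2 q * p3 q ^ 2"
text \<open>This is Ramanujan's psi at \<open>q^2\<close>, not at \<open>q\<close>. The product form
  makes holomorphy and absence of zeros in the disc evident.\<close>

definition psi :: "complex \<Rightarrow> complex" where "psi q = euler2 q * p2 q ^ 2"

lemma euler2_minus [simp]: "euler2 (- q) = euler2 q"
  by (simp add: euler2_def)

lemma norm_power_less_one [simp]:
  "norm (q::complex) < 1 \<Longrightarrow> 0 < n \<Longrightarrow> norm (q ^ n) < 1"
  by (simp add: norm_power power_less_one_iff)

lemma euler2_nonzero: "norm q < 1 \<Longrightarrow> euler2 q \<noteq> 0"
  and p2_nonzero: "norm q < 1 \<Longrightarrow> p2 q \<noteq> 0"
  and p3_nonzero: "norm q < 1 \<Longrightarrow> p3 q \<noteq> 0"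
  by (auto simp: euler2_def p2_def p3_def qp_nonzero)

lemma phi_nonzero: "norm q < 1 \<Longrightarrow> phi q \<noteq> 0"
  and psi_nonzero: "norm q < 1 \<Longrightarrow> psi q \<noteq> 0"
  by (auto simp: phi_def psi_def euler2_nonzero p2_nonzero p3_nonzero)

lemma theta_at_0 [simp]: "euler2 0 = 1" "p2 0 = 1" "p3 0 = 1" "phi 0 = 1" "psi 0 = 1"
  by (simp_all add: euler2_def p2_def p3_def phi_def psi_def)

lemma euler2_eq:
  assumes "norm q < 1"
  shows "euler2 q = p3 (- (q ^ 2)) * euler2 (q ^ 2)"
  using qp_split[OF norm_power_less_one[OF assms, of 2], of 2 "q ^ 2"]
  by (simp add: euler2_def p3_def numeral_2_eq_2 power2_eq_square flip: power_mult)

lemma p2_eq: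
  assumes "norm q < 1"
  shows "p2 q = p3 (q ^ 2) * p2 (q ^ 2)"
  using qp_split[OF norm_power_less_one[OF assms, of 2], of 2 "- (q ^ 2)"]
  by (simp add: p2_def p3_def numeral_2_eq_2 power2_eq_square flip: power_mult)

lemma p3_mult_p3_minus:
  assumes "norm q < 1"
  shows "p3 q * p3 (- q) = p3 (- (q ^ 2))"
  using qp_mult_minus[of "q ^ 2" "q"] assms
  by (simp add: p3_def mult.commute)

text \<open>Euler's identity: multiplying by \<open>euler2 q\<close> turns \<open>p2 q\<close> into
  \<open>euler2 (q ^ 2)\<close>, while the odd factors in \<open>euler2 q\<close> are
  \<open>p3 q * p3 (- q)\<close>.\<close>

lemma p_product:
  assumes "norm q < 1"
  shows "p2 q * p3 q * p3 (- q) = 1"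
proof -
  have "euler2 q * p2 q = euler2 (q ^ 2)"
    using qp_mult_minus[of "q ^ 2" "q ^ 2"] assms by (simp add: euler2_def p2_def)
  then have "p3 (- (q ^ 2)) * euler2 (q ^ 2) * p2 q = euler2 (q ^ 2)"
    using euler2_eq[OF assms] by simp
  then have "p3 (- (q ^ 2)) * p2 q = 1"
    using euler2_nonzero[of "q ^ 2"] assms by simp
  then show ?thesis
    using p3_mult_p3_minus[OF assms] by (simp add: mult_ac)
qed

lemma phi_mult_phi_minus:
  assumes "norm q < 1"
  shows "phi q * phi (- q) = phi (- (q ^ 2)) ^ 2"
proof -
  have "phi q * phi (- q) = euler2 q ^ 2 * (p3 q * p3 (- q)) ^ 2"
    by (simp add: phi_def power2_eq_square)
  also have "\<dots> = phi (- (q ^ 2)) ^ 2"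
    unfolding p3_mult_p3_minus[OF assms] euler2_eq[OF assms]
    by (simp add: phi_def power2_eq_square)
  finally show ?thesis .
qed

lemma psi_square:
  assumes "norm q < 1"
  shows "psi q ^ 2 = psi (q ^ 2) * phi (q ^ 2)"
proof -
  have "psi q ^ 2 = euler2 (q ^ 2) ^ 2 * p3 (q ^ 2) ^ 2 * p2 (q ^ 2) ^ 2 *
      (p2 (q ^ 2) * p3 (q ^ 2) * p3 (- (q ^ 2))) ^ 2"
    unfolding psi_def euler2_eq[OF assms] p2_eq[OF assms] by algebra
  also have "\<dots> = psi (q ^ 2) * phi (q ^ 2)"
    unfolding p_product[OF norm_power_less_one[OF assms pos2]] psi_def phi_def
    by (simp add: power2_eq_square)
  finally show ?thesis .
qed

section \<open>Theta series, quadratic relations, and \<open>z\<close> and \<open>Z\<close> in terms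
  of theta products\<close>

lemma theta_has_sum:
  fixes q :: complex
  assumes "norm q < 1" "q \<noteq> 0" "a > 0"
  shows "((\<lambda>n. q powi (int a * n ^ 2 + c * n)) has_sum
     (qp (q ^ (2 * a)) (q ^ (2 * a)) * qp (- (q powi (int a + c))) (q ^ (2 * a))
        * qp (- (q powi (int a - c))) (q ^ (2 * a)))) UNIV"
proof -
  define Q where "Q = q ^ a"
  have Q: "norm Q < 1" "Q \<noteq> 0" using assms by (auto simp: Q_def)
  have "((\<lambda>j. (q powi c) powi j * Q powi (j ^ 2)) has_sum
          (qp (Q ^ 2) (Q ^ 2) * qp (- ((q powi c) * Q)) (Q ^ 2) * qp (- (Q / (q powi c))) (Q ^ 2))) UNIV"
    by (rule jacobi_triple_product) (use Q assms in auto)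
  moreover have "(q powi c) powi j * Q powi (j ^ 2) = q powi (int a * j ^ 2 + c * j)" for j
    using assms unfolding Q_def power_int_power power_int_mult [symmetric]
    by (simp flip: power_int_add) (simp add: add.commute)
  moreover have "Q ^ 2 = q ^ (2 * a)" by (simp add: Q_def mult.commute flip: power_mult)
  moreover have "(q powi c) * Q = q powi (int a + c)"
    using assms by (simp add: power_int_add Q_def)
  moreover have "Q / (q powi c) = q powi (int a - c)"
    using assms by (simp add: power_int_diff Q_def)
  ultimately show ?thesis by simp
qed

lemma phi_has_sum:
  assumes "norm q < 1" "q \<noteq> 0"
  shows "((\<lambda>n. q powi (n ^ 2)) has_sum phi q) UNIV"
  using theta_has_sum[OF assms, of 1 0] by (simp add: phi_def euler2_def p3_def power2_eq_square mult_ac)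

lemma psi_has_sum:
  assumes "norm q < 1" "q \<noteq> 0"
  shows "((\<lambda>n. q powi (n ^ 2 + n)) has_sum 2 * psi q) UNIV"
proof -
  have q2: "norm (q ^ 2) < 1" using assms by simp
  \<comment> \<open>The factor 2 is the leading factor \<open>1 + 1\<close> of the product.\<close>
  have "qp (- 1) (q ^ 2) = 2 * qp (- (q ^ 2)) (q ^ 2)"
    using prodinf_split_head[OF qp_convergent[OF q2, of "- 1"]] qp_convergent[OF q2, of "- 1"]
    by (simp add: qp_def mult.commute)
  then show ?thesis
    using theta_has_sum[OF assms, of 1 1]
    by (simp add: psi_def euler2_def p2_def power2_eq_square mult_ac)
qed

lemma phi_square_has_sum:
  assumes "norm q < 1" "q \<noteq> 0"
  shows "((\<lambda>(m, n). q powi (m ^ 2 + n ^ 2)) has_sum phi q ^ 2) UNIV"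
  using has_sum_times[OF phi_has_sum[OF assms] phi_has_sum[OF assms]] assms
  by (simp add: power2_eq_square power_int_add)

lemma psi_square_has_sum:
  assumes "norm q < 1" "q \<noteq> 0"
  shows "((\<lambda>(m, n). q powi (m ^ 2 + m + (n ^ 2 + n))) has_sum 4 * psi q ^ 2) UNIV"
proof -
  have "((\<lambda>(m, n). q powi (m ^ 2 + m) * q powi (n ^ 2 + n)) has_sum 4 * psi q ^ 2) UNIV"
    using has_sum_times[OF psi_has_sum[OF assms] psi_has_sum[OF assms]]
    by (simp add: power2_eq_square)
  then show ?thesis using assms by (simp add: power_int_add mult_ac)
qed

text \<open>In the two classes modulo \<open>1 + i\<close> the norm \<open>m ^ 2 + n ^ 2\<close> is
  \<open>2 (a ^ 2 + b ^ 2)\<close> and \<open>1 + 2 (a ^ 2 + a + b ^ 2 + b)\<close>. Only the odd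
  class sees the sign of \<open>q\<close>.\<close>

lemma phi_square_parity:
  assumes q: "norm q < 1" "q \<noteq> 0"
  shows "phi q ^ 2 = phi (q ^ 2) ^ 2 + 4 * q * psi (q ^ 2) ^ 2"
    and "phi (- q) ^ 2 = phi (q ^ 2) ^ 2 - 4 * q * psi (q ^ 2) ^ 2"
proof -
  have q2: "norm (q ^ 2) < 1" "q ^ 2 \<noteq> 0" using q by auto
  have *: "phi r ^ 2 = phi (q ^ 2) ^ 2 + 4 * r * psi (q ^ 2) ^ 2"
    if r: "norm r < 1" "r \<noteq> 0" "r ^ 2 = q ^ 2" for r
  proof -
    let ?F = "\<lambda>(m, n). r powi (m ^ 2 + n ^ 2)"
    have "phi r ^ 2 = infsum ?F UNIV"
      using phi_square_has_sum[OF r(1,2)] by (simp add: infsumI)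
    also have "\<dots> = infsum (\<lambda>(a, b). ?F (a + b, a - b)) UNIV
                        + infsum (\<lambda>(a, b). ?F (a + b + 1, a - b)) UNIV"
      by (intro infsum_parity_cosets has_sum_imp_summable[OF phi_square_has_sum[OF r(1,2)]])
    also have "(\<lambda>(a, b). ?F (a + b, a - b)) = (\<lambda>(a, b). (q ^ 2) powi (a ^ 2 + b ^ 2))"
      unfolding r(3)[symmetric] power_int_power
      by (auto simp: fun_eq_iff power2_eq_square algebra_simps)
    also have "infsum \<dots> UNIV = phi (q ^ 2) ^ 2"
      using phi_square_has_sum[OF q2] by (rule infsumI)
    also have "(\<lambda>(a, b). ?F (a + b + 1, a - b)) =
               (\<lambda>x. r * (case x of (a, b) \<Rightarrow> (q ^ 2) powi (a ^ 2 + a + (b ^ 2 + b))))"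
    proof (clarsimp simp: fun_eq_iff)
      fix a b :: int
      have "(a + b + 1) ^ 2 + (a - b) ^ 2 = 1 + 2 * (a ^ 2 + a + (b ^ 2 + b))"
        by (simp add: power2_eq_square algebra_simps)
      then show "r powi ((a + b + 1) ^ 2 + (a - b) ^ 2) = r * q\<^sup>2 powi (a\<^sup>2 + a + (b\<^sup>2 + b))"
        using r by (simp add: power_int_add power_int_power flip: r(3))
    qed
    also have "infsum \<dots> UNIV = r * (4 * psi (q ^ 2) ^ 2)"
      by (rule infsumI[OF has_sum_cmult_right[OF psi_square_has_sum[OF q2]]])
    finally show ?thesis by simp
  qed
  show "phi q ^ 2 = phi (q ^ 2) ^ 2 + 4 * q * psi (q ^ 2) ^ 2"
    using *[of q] q by simp
  show "phi (- q) ^ 2 = phi (q ^ 2) ^ 2 - 4 * q * psi (q ^ 2) ^ 2"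
    using *[of "- q"] q by simp
qed

text \<open>Multiples of \<open>2 + i\<close> have norm five times that of the quotient and
  contribute \<open>phi (q ^ 5) ^ 2\<close>. On the coset of 1 the norm separates in
  \<open>a\<close> and \<open>b\<close>, so that sum is a product of two theta series.\<close>

lemma phi_square_quintic:
  assumes q: "norm q < 1" "q \<noteq> 0"
  shows "phi q ^ 2 * p3 (q ^ 5) = phi (q ^ 5) ^ 2 * p3 (q ^ 5) + 4 * q * euler2 (q ^ 5) ^ 2 * p3 q"
proof -
  let ?F = "\<lambda>(m, n). q powi (m ^ 2 + n ^ 2)"
  define A where "A = euler2 (q ^ 5) * qp (- (q ^ 9)) (q ^ 10) * qp (- q) (q ^ 10)"
  define B where "B = euler2 (q ^ 5) * qp (- (q ^ 3)) (q ^ 10) * qp (- (q ^ 7)) (q ^ 10)"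
  have q5: "norm (q ^ 5) < 1" "q ^ 5 \<noteq> 0" using q by auto
  have A: "((\<lambda>n. q powi (5 * n ^ 2 + 4 * n)) has_sum A) UNIV"
    using theta_has_sum[OF q, of 5 4] by (simp add: A_def euler2_def flip: power_mult)
  have B: "((\<lambda>n. q powi (5 * n ^ 2 - 2 * n)) has_sum B) UNIV"
    using theta_has_sum[OF q, of 5 "-2"] by (simp add: B_def euler2_def flip: power_mult)
  have "phi q ^ 2 = infsum ?F UNIV"
    using phi_square_has_sum[OF q] by (simp add: infsumI)
  also have "\<dots> = infsum (\<lambda>(a, b). ?F (2 * a - b, a + 2 * b + 0)) UNIV
                      + 4 * infsum (\<lambda>(a, b). ?F (2 * a - b + 1, a + 2 * b + 0)) UNIV"
    by (intro infsum_gauss_cosets has_sum_imp_summable[OF phi_square_has_sum[OF q]])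
       (auto simp: power2_eq_square algebra_simps)
  also have "(\<lambda>(a, b). ?F (2 * a - b, a + 2 * b + 0)) = (\<lambda>(a, b). (q ^ 5) powi (a ^ 2 + b ^ 2))"
    unfolding power_int_power by (auto simp: fun_eq_iff power2_eq_square algebra_simps)
  also have "infsum \<dots> UNIV = phi (q ^ 5) ^ 2"
    using phi_square_has_sum[OF q5] by (rule infsumI)
  also have "(\<lambda>(a, b). ?F (2 * a - b + 1, a + 2 * b + 0)) =
      (\<lambda>x. q * (case x of (a, b) \<Rightarrow> q powi (5 * a ^ 2 + 4 * a) * q powi (5 * b ^ 2 - 2 * b)))"
  proof (clarsimp simp: fun_eq_iff)
    fix a b :: int
    have "(2 * a - b + 1) ^ 2 + (a + 2 * b) ^ 2 = 1 + (5 * a ^ 2 + 4 * a) + (5 * b ^ 2 - 2 * b)"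
      by (simp add: power2_eq_square algebra_simps)
    then show "q powi ((2 * a - b + 1) ^ 2 + (a + 2 * b) ^ 2) =
        q * (q powi (5 * a ^ 2 + 4 * a) * q powi (5 * b ^ 2 - 2 * b))"
      using q by (simp only: power_int_add power_int_1_right mult_ac simp_thms)
  qed
  also have "infsum \<dots> UNIV = q * (A * B)"
    by (rule infsumI[OF has_sum_cmult_right[OF has_sum_times[OF A B]]])
  finally have "phi q ^ 2 = phi (q ^ 5) ^ 2 + 4 * (q * (A * B))" .
  \<comment> \<open>The factors of \<open>A\<close> and \<open>B\<close> are four of the five
    residue classes of \<open>p3 q\<close>; the missing one is \<open>p3 (q ^ 5)\<close>.\<close>
  moreover have "p3 q = qp (- q) (q ^ 10) * qp (- (q ^ 3)) (q ^ 10) * p3 (q ^ 5) *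
      qp (- (q ^ 7)) (q ^ 10) * qp (- (q ^ 9)) (q ^ 10)"
    using qp_split[OF norm_power_less_one[OF q(1) pos2], of 5 "- q"]
    by (simp add: p3_def eval_nat_numeral mult_ac flip: power_mult)
  ultimately show ?thesis
    by (simp add: A_def B_def power2_eq_square algebra_simps)
qed

text \<open>The same splitting with \<open>e = 1\<close>: up to the constant 1/2 the exponent is the
  norm of a Gaussian integer shifted by \<open>(1/2, 1/2)\<close>.\<close>

lemma psi_square_quintic:
  assumes q: "norm q < 1" "q \<noteq> 0"
  shows "psi q ^ 2 * p2 (q ^ 5) = q ^ 2 * psi (q ^ 5) ^ 2 * p2 (q ^ 5) + euler2 (q ^ 5) ^ 2 * p2 q"
proof -
  let ?F = "\<lambda>(m, n). q powi (m ^ 2 + m + (n ^ 2 + n))"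
  define A where "A = euler2 (q ^ 5) * qp (- (q ^ 4)) (q ^ 10) * qp (- (q ^ 6)) (q ^ 10)"
  define B where "B = euler2 (q ^ 5) * qp (- (q ^ 8)) (q ^ 10) * qp (- (q ^ 2)) (q ^ 10)"
  have q5: "norm (q ^ 5) < 1" "q ^ 5 \<noteq> 0" using q by auto
  have A': "((\<lambda>n. q powi (5 * n ^ 2 - n)) has_sum A) UNIV"
    using theta_has_sum[OF q, of 5 "-1"] by (simp add: A_def euler2_def flip: power_mult)
  \<comment> \<open>The coset produces
    \<open>5 n ^ 2 + 9 n + 4 = 5 (n + 1) ^ 2 - (n + 1)\<close>.\<close>
  have "((\<lambda>n. q powi (5 * n ^ 2 - n)) has_sum A) UNIV =
        ((\<lambda>n. q powi (5 * n ^ 2 + 9 * n + 4)) has_sum A) UNIV"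
    by (rule has_sum_reindex_bij_witness[of _ "\<lambda>n. n + 1" "\<lambda>n. n - 1"])
       (auto simp: power2_eq_square algebra_simps)
  with A' have A: "((\<lambda>n. q powi (5 * n ^ 2 + 9 * n + 4)) has_sum A) UNIV" by simp
  have B: "((\<lambda>n. q powi (5 * n ^ 2 + 3 * n)) has_sum B) UNIV"
    using theta_has_sum[OF q, of 5 3] by (simp add: B_def euler2_def flip: power_mult)
  have "4 * psi q ^ 2 = infsum ?F UNIV"
    using psi_square_has_sum[OF q] by (simp add: infsumI)
  also have "\<dots> = infsum (\<lambda>(a, b). ?F (2 * a - b, a + 2 * b + 1)) UNIV
                      + 4 * infsum (\<lambda>(a, b). ?F (2 * a - b + 1, a + 2 * b + 1)) UNIV"
    by (intro infsum_gauss_cosets has_sum_imp_summable[OF psi_square_has_sum[OF q]])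
       (auto simp: power2_eq_square algebra_simps)
  also have "(\<lambda>(a, b). ?F (2 * a - b, a + 2 * b + 1)) =
      (\<lambda>x. q ^ 2 * (case x of (a, b) \<Rightarrow> (q ^ 5) powi (a ^ 2 + a + (b ^ 2 + b))))"
  proof -
    have e: "(2 * a - b) ^ 2 + (2 * a - b) + ((a + 2 * b + 1) ^ 2 + (a + 2 * b + 1)) =
        2 + 5 * (a ^ 2 + a + (b ^ 2 + b))"
      for a b :: int
      by (simp add: power2_eq_square algebra_simps)
    have e2: "q powi ((2 * a - b) ^ 2 + (2 * a - b) + ((a + 2 * b + 1) ^ 2 + (a + 2 * b + 1))) =
        q ^ 2 * (q ^ 5) powi (a ^ 2 + a + (b ^ 2 + b))"
      for a b :: int unfolding e power_int_power using q by (subst power_int_add) auto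
    show ?thesis
      by (simp only: fun_eq_iff split_paired_All case_prod_conv e2) simp
  qed
  also have "infsum \<dots> UNIV = q ^ 2 * (4 * psi (q ^ 5) ^ 2)"
    by (rule infsumI[OF has_sum_cmult_right[OF psi_square_has_sum[OF q5]]])
  also have "(\<lambda>(a, b). ?F (2 * a - b + 1, a + 2 * b + 1)) =
      (\<lambda>(a, b). q powi (5 * a ^ 2 + 9 * a + 4) * q powi (5 * b ^ 2 + 3 * b))"
  proof -
    have e: "(2 * a - b + 1) ^ 2 + (2 * a - b + 1) + ((a + 2 * b + 1) ^ 2 + (a + 2 * b + 1)) =
        (5 * a ^ 2 + 9 * a + 4) + (5 * b ^ 2 + 3 * b)" for a b :: int
      by (simp add: power2_eq_square algebra_simps)
    have e2: "q powi ((5 * a ^ 2 + 9 * a + 4) + (5 * b ^ 2 + 3 * b)) =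
        q powi (5 * a ^ 2 + 9 * a + 4) * q powi (5 * b ^ 2 + 3 * b)" for a b
      by (rule power_int_add) (use q in simp)
    show ?thesis
      by (simp only: fun_eq_iff split_paired_All case_prod_conv e e2) simp
  qed
  also have "infsum \<dots> UNIV = A * B"
    by (rule infsumI[OF has_sum_times[OF A B]])
  finally have "4 * psi q ^ 2 = 4 * (q ^ 2 * psi (q ^ 5) ^ 2 + A * B)"
    by (simp only: distrib_left mult.left_commute)
  then have "psi q ^ 2 = q ^ 2 * psi (q ^ 5) ^ 2 + A * B"
    unfolding mult_cancel_left by simp
  moreover have "p2 q = qp (- (q ^ 2)) (q ^ 10) * qp (- (q ^ 4)) (q ^ 10) *
      qp (- (q ^ 6)) (q ^ 10) * qp (- (q ^ 8)) (q ^ 10) * p2 (q ^ 5)"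
    using qp_split[OF norm_power_less_one[OF q(1) pos2], of 5 "- (q ^ 2)"]
    by (simp add: p2_def eval_nat_numeral mult_ac flip: power_mult)
  ultimately show ?thesis
    by (simp add: A_def B_def power2_eq_square algebra_simps)
qed

lemma z_eq:
  assumes "norm q < 1"
  shows "z q = q * euler2 q ^ 2 * euler2 (q ^ 5) ^ 2"
proof (cases "q = 0")
  case False
  define \<tau> where "\<tau> = Ln q / (2 * of_real pi * \<i>)"
  have n: "nome \<tau> = q"
    using False by (simp add: nome_def \<tau>_def)
  have "z q = eta_sub 2 \<tau> ^ 2 * eta_sub 10 \<tau> ^ 2"
    using False by (simp add: z_def \<tau>_def Let_def)
  then show ?thesis
    unfolding eta_quotient_nome n by (simp add: euler2_def qp_def flip: power_mult)
qed (simp add: z_def)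

lemma Z_eq:
  assumes "norm q < 1"
  shows "Z q = phi q ^ 2 * phi (q ^ 5) ^ 2"
proof (cases "q = 0")
  case True
  \<comment> \<open>At \<open>q = 0\<close> only the term \<open>m = n = 0\<close> survives, because
    \<open>0 ^ 0 = 1\<close>.\<close>
  have 1: "(0::complex) ^ nat (m\<^sup>2 + 5 * n\<^sup>2) = (if n = 0 then if m = 0 then 1 else 0 else 0)"
    for m n :: int
  proof -
    have "nat (m\<^sup>2 + 5 * n\<^sup>2) = 0 \<longleftrightarrow> m = 0 \<and> n = 0"
      by (smt (verit) nat_0_iff zero_le_power2 zero_eq_power2)
    then show ?thesis by (simp add: power_0_left)
  qed
  have 2: "infsum (\<lambda>n::int. if n = 0 then c else 0) UNIV = c" for c :: complex
    by (rule infsumI, rule has_sum_finite_neutralI[of "{0::int}"]) auto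
  have "Z 0 = 1"
    unfolding Z_def 1 2 by simp
  then show ?thesis using True by simp
next
  case False
  note q = assms False
  have q5: "norm (q ^ 5) < 1" "q ^ 5 \<noteq> 0" using q by auto
  have "q ^ nat (m\<^sup>2 + 5 * n\<^sup>2) = q powi (m ^ 2) * (q ^ 5) powi (n ^ 2)" for m n :: int
    using q by (simp add: power_int_power flip: power_int_add) (simp add: power_int_def)
  then have "Z q = (\<Sum>\<^sub>\<infinity>m::int. \<Sum>\<^sub>\<infinity>n::int. q powi (m ^ 2) * (q ^ 5) powi (n ^ 2)) ^ 2"
    by (simp add: Z_def)
  also have "\<dots> = (\<Sum>\<^sub>\<infinity>m::int. q powi (m ^ 2) * phi (q ^ 5)) ^ 2"
    by (simp add: infsumI[OF has_sum_cmult_right[OF phi_has_sum[OF q5]]])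
  also have "\<dots> = (phi q * phi (q ^ 5)) ^ 2"
    by (simp add: infsumI[OF has_sum_cmult_left[OF phi_has_sum[OF q]]])
  finally show ?thesis by (simp add: power_mult_distrib)
qed

lemma holomorphic_theta:
  "euler2 holomorphic_on ball 0 1" "p2 holomorphic_on ball 0 1" "p3 holomorphic_on ball 0 1"
  "phi holomorphic_on ball 0 1" "psi holomorphic_on ball 0 1"
proof -
  show 1: "euler2 holomorphic_on ball 0 1"
    unfolding euler2_def [abs_def] by (intro holomorphic_qp holomorphic_intros) auto
  show 2: "p2 holomorphic_on ball 0 1"
    unfolding p2_def [abs_def] by (intro holomorphic_qp holomorphic_intros) auto
  show 3: "p3 holomorphic_on ball 0 1"
    unfolding p3_def [abs_def] by (intro holomorphic_qp holomorphic_intros) auto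
  show "phi holomorphic_on ball 0 1" "psi holomorphic_on ball 0 1"
    unfolding phi_def [abs_def] psi_def [abs_def] by (intro holomorphic_intros 1 2 3)+
qed

section \<open>Differential equations for theta functions\<close>

text \<open>Jacobi's quartic identity: the two parity formulas have squares differing by four times
  the product of their terms, which \<open>psi_square\<close> folds back to
  \<open>q\<close>.\<close>

lemma phi_pow4_diff:
  assumes q: "norm q < 1"
  shows "phi q ^ 4 - phi (- q) ^ 4 = 16 * q * psi q ^ 4"
proof (cases "q = 0")
  case False
  have "phi q ^ 4 - phi (- q) ^ 4 = (phi q ^ 2) ^ 2 - (phi (- q) ^ 2) ^ 2" by simp
  also have "\<dots> = 16 * q * (psi (q ^ 2) * phi (q ^ 2)) ^ 2"
    unfolding phi_square_parity[OF q False] by algebra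
  also have "\<dots> = 16 * q * psi q ^ 4"
    unfolding psi_square[OF q, symmetric] by simp
  finally show ?thesis .
qed simp

lemma has_field_derivative_unique_on_open:
  fixes f g :: "complex \<Rightarrow> complex"
  assumes "open S" "q \<in> S" "\<And>x. x \<in> S \<Longrightarrow> f x = g x"
    and "(f has_field_derivative f') (at q)" "(g has_field_derivative g') (at q)"
  shows "f' = g'"
  using has_field_derivative_transform_within_open[OF assms(4,1,2,3)] assms(5) DERIV_unique by blast

lemma has_field_derivative_comp_ball:
  fixes f g :: "complex \<Rightarrow> complex"
  assumes "f holomorphic_on ball 0 1" "(g has_field_derivative g') (at x)" "norm (g x) < 1"
  shows "((\<lambda>x. f (g x)) has_field_derivative deriv f (g x) * g') (at x)"
proof -
  have "(f has_field_derivative deriv f (g x)) (at (g x))"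
    using assms by (intro holomorphic_derivI[OF assms(1)]) auto
  then show ?thesis using assms(2) by (rule DERIV_chain2)
qed

lemma holomorphic_comp_ball:
  fixes f g :: "complex \<Rightarrow> complex"
  assumes "f holomorphic_on ball 0 1" "g holomorphic_on S" "\<And>x. x \<in> S \<Longrightarrow> norm (g x) < 1"
  shows "(\<lambda>x. f (g x)) holomorphic_on S"
proof -
  have "g ` S \<subseteq> ball 0 1" using assms(3) by auto
  then show ?thesis
    using holomorphic_on_compose_gen[OF assms(2,1)] by (simp add: o_def)
qed

lemmas phi_deriv [derivative_intros] = has_field_derivative_comp_ball[OF holomorphic_theta(4)]
  and psi_deriv [derivative_intros] = has_field_derivative_comp_ball[OF holomorphic_theta(5)]

text \<open>The linear coefficient is read off by differentiating the odd part of
  \<open>phi q ^ 2\<close>.\<close>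

lemma deriv_phi_0: "deriv phi 0 = 2"
proof -
  have "2 * phi 0 * deriv phi 0 - 2 * phi (- 0) * (- deriv phi (- 0)) = 8 * psi (0 ^ 2) ^ 2"
  proof (rule has_field_derivative_unique_on_open[of "ball 0 1" 0 "\<lambda>q. phi q ^ 2 - phi (- q) ^ 2"
        "\<lambda>q. 8 * q * psi (q ^ 2) ^ 2"])
    show "phi q ^ 2 - phi (- q) ^ 2 = 8 * q * psi (q ^ 2) ^ 2" if "q \<in> ball 0 1" for q
      using that phi_square_parity[of q] by (cases "q = 0") auto
  qed (auto intro!: derivative_eq_intros)
  then show ?thesis by simp
qed

section \<open>The logarithmic derivative of \<open>phi\<close> with respect to
  \<open>D = q d/dq\<close>\<close>

definition phi_ld :: "complex \<Rightarrow> complex" where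
  "phi_ld q = q * deriv phi q / phi q"

lemma holomorphic_phi_ld: "phi_ld holomorphic_on ball 0 1"
  unfolding phi_ld_def [abs_def]
  by (intro holomorphic_intros holomorphic_theta) (auto simp: phi_nonzero)

lemmas phi_ld_deriv [derivative_intros] = has_field_derivative_comp_ball[OF holomorphic_phi_ld]

lemma deriv_phi_eq:
  assumes "norm q < 1"
  shows "q * deriv phi q = phi_ld q * phi q"
  using phi_nonzero[OF assms] by (simp add: phi_ld_def)

lemma phi_ld_sum_weighted:
  assumes q: "norm q < 1"
  shows "phi q ^ 2 * phi_ld q + phi (- q) ^ 2 * phi_ld (- q) = 4 * phi (q ^ 2) ^ 2 * phi_ld (q ^ 2)"
proof -
  have q2: "norm (q ^ 2) < 1" and qm: "norm (- q) < 1" using q by auto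
  have "2 * phi q * deriv phi q + 2 * phi (- q) * (- deriv phi (- q)) =
        4 * phi (q ^ 2) * (deriv phi (q ^ 2) * (2 * q))"
  proof (rule has_field_derivative_unique_on_open[of "ball 0 1" q "\<lambda>q. phi q ^ 2 + phi (- q) ^ 2"
        "\<lambda>q. 2 * phi (q ^ 2) ^ 2"])
    show "phi q ^ 2 + phi (- q) ^ 2 = 2 * phi (q ^ 2) ^ 2" if "q \<in> ball 0 1" for q
      using that phi_square_parity[of q] by (cases "q = 0") auto
  qed (use q in \<open>auto intro!: derivative_eq_intros\<close>)
  then have "2 * phi q * (q * deriv phi q) + 2 * phi (- q) * ((- q) * deriv phi (- q)) =
        8 * phi (q ^ 2) * (q ^ 2 * deriv phi (q ^ 2))"
    by algebra
  then show ?thesis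
    unfolding deriv_phi_eq[OF q] deriv_phi_eq[OF qm] deriv_phi_eq[OF q2] by algebra
qed

text \<open>Logarithmic derivative of \<open>phi_mult_phi_minus\<close>.\<close>

lemma phi_ld_sum:
  assumes q: "norm q < 1"
  shows "phi_ld q + phi_ld (- q) = 4 * phi_ld (- (q ^ 2))"
proof -
  have q2: "norm (- (q ^ 2)) < 1" and qm: "norm (- q) < 1" using q by auto
  have "deriv phi q * phi (- q) + phi q * (- deriv phi (- q)) =
        2 * phi (- (q ^ 2)) * (deriv phi (- (q ^ 2)) * (- 2 * q))"
    by (rule has_field_derivative_unique_on_open[of "ball 0 1" q "\<lambda>q. phi q * phi (- q)"
        "\<lambda>q. phi (- (q ^ 2)) ^ 2"])
       (use q in \<open>auto intro!: derivative_eq_intros phi_mult_phi_minus\<close>)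
  then have "(q * deriv phi q) * phi (- q) + phi q * ((- q) * deriv phi (- q)) =
        4 * phi (- (q ^ 2)) * ((- (q ^ 2)) * deriv phi (- (q ^ 2)))"
    by algebra
  then have "(phi_ld q + phi_ld (- q)) * (phi q * phi (- q)) =
        4 * phi_ld (- (q ^ 2)) * phi (- (q ^ 2)) ^ 2"
    unfolding deriv_phi_eq[OF q] deriv_phi_eq[OF qm] deriv_phi_eq[OF q2] by algebra
  then show ?thesis
    unfolding phi_mult_phi_minus[OF q] using phi_nonzero[OF q2] by simp
qed

lemma tendsto_iterated_square:
  fixes q :: complex
  assumes "norm q < 1"
  shows "(\<lambda>n. q ^ (2 ^ n)) \<longlonglongrightarrow> 0"
proof (rule filterlim_compose[OF LIMSEQ_power_zero[OF assms]])
  show "filterlim (\<lambda>n. 2 ^ n :: nat) sequentially sequentially"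
    by (rule filterlim_subseq) (auto simp: strict_mono_def)
qed

lemma square_invariant_constant:
  fixes G :: "complex \<Rightarrow> complex"
  assumes "isCont G 0" "\<And>q. norm q < 1 \<Longrightarrow> G (q ^ 2) = G q" and q: "norm q < 1"
  shows "G q = G 0"
proof -
  have "G (q ^ (2 ^ n)) = G q" for n
  proof (induction n)
    case (Suc n)
    then show ?case
      using assms(2)[of "q ^ (2 ^ n)"] q by (simp add: mult.commute flip: power_mult)
  qed simp
  then have "(\<lambda>n. G (q ^ (2 ^ n))) \<longlonglongrightarrow> G q" by simp
  moreover have "(\<lambda>n. G (q ^ (2 ^ n))) \<longlonglongrightarrow> G 0"
    by (rule isCont_tendsto_compose[OF assms(1) tendsto_iterated_square[OF q]])
  ultimately show ?thesis by (rule LIMSEQ_unique)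
qed

text \<open>\<open>D log (\<theta>_3 / \<theta>_4) = \<theta>_2^4 / 4\<close> classically. The
  quotient \<open>G\<close> of the two sides, up to the factor 4, is invariant under
  \<open>q \<mapsto> q^2\<close>, hence constant.\<close>

lemma phi_ld_diff:
  assumes q: "norm q < 1"
  shows "phi_ld q - phi_ld (- q) = 4 * q * psi q ^ 4"
proof -
  \<comment> \<open>The difference vanishes at 0; \<open>N\<close> is its quotient by
    \<open>q\<close>, written so that it is holomorphic at 0.\<close>
  define N where "N q = deriv phi q / phi q + deriv phi (- q) / phi (- q)" for q
  have N: "phi_ld q - phi_ld (- q) = q * N q" for q
    by (simp add: phi_ld_def N_def algebra_simps)
  define G where "G q = N q / psi q ^ 4" for q
  have "G holomorphic_on ball 0 1"
    unfolding G_def N_def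
    by (intro holomorphic_intros holomorphic_theta
          holomorphic_comp_ball[OF holomorphic_theta(4)]
          holomorphic_comp_ball[OF holomorphic_deriv[OF holomorphic_theta(4)]])
       (auto simp: phi_nonzero psi_nonzero)
  then have cont: "isCont G 0"
    by (meson analytic_at centre_in_ball analytic_at_imp_isCont open_ball zero_less_one)
  have "G (q ^ 2) = G q" if q: "norm q < 1" for q
  proof (cases "q = 0")
    case False
    have q2: "norm (q ^ 2) < 1" using q by simp
    \<comment> \<open>Subtracting \<open>y\<close> times \<open>phi_ld_sum\<close> from the weighted
      sum leaves only differences, at \<open>q\<close> on one side and at \<open>q ^ 2\<close> on
      the other.\<close>
    define y t where "y = phi (q ^ 2) ^ 2" and "t = 4 * q * psi (q ^ 2) ^ 2"
    have p: "phi q ^ 2 = y + t" "phi (- q) ^ 2 = y - t"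
      using phi_square_parity[OF q False] by (auto simp: y_def t_def)
    have "(y + t) * phi_ld q + (y - t) * phi_ld (- q) = 4 * y * phi_ld (q ^ 2)"
      using phi_ld_sum_weighted[OF q] unfolding p y_def .
    moreover have "y * phi_ld q + y * phi_ld (- q) = 4 * y * phi_ld (- (q ^ 2))"
      using arg_cong[OF phi_ld_sum[OF q], of "\<lambda>x. y * x"] by (simp add: algebra_simps)
    ultimately have "t * (phi_ld q - phi_ld (- q)) = 4 * y * (phi_ld (q ^ 2) - phi_ld (- (q ^ 2)))"
      by algebra
    then have "4 * q ^ 2 * (psi (q ^ 2) ^ 2 * N q) = 4 * q ^ 2 * (phi (q ^ 2) ^ 2 * N (q ^ 2))"
      unfolding N y_def t_def by algebra
    then have 1: "psi (q ^ 2) ^ 2 * N q = phi (q ^ 2) ^ 2 * N (q ^ 2)"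
      using False by simp
    have 2: "psi q ^ 4 = psi (q ^ 2) ^ 2 * phi (q ^ 2) ^ 2"
      using psi_square[OF q] by algebra
    show ?thesis
      unfolding G_def 2 using 1 phi_nonzero[OF q2] psi_nonzero[OF q2]
      by (simp add: field_simps eval_nat_numeral)
  qed simp
  then have "G q = G 0"
    using square_invariant_constant[OF cont _ q] by blast
  also have "G 0 = 4"
    by (simp add: G_def N_def deriv_phi_0)
  finally have "N q = 4 * psi q ^ 4"
    using psi_nonzero[OF q] by (simp add: G_def field_simps)
  then show ?thesis unfolding N by simp
qed

text \<open>Eliminating \<open>phi_ld (- q)\<close> from the weighted sum expresses the value at
  \<open>q ^ 2\<close> by data at \<open>q\<close>; this drives the recursion in
  \<open>deriv_phi_ld\<close>.\<close>

lemma phi_ld_square: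
  assumes q: "norm q < 1"
  shows "2 * phi_ld (q ^ 2) = phi_ld q - phi (- q) ^ 2 * (phi q ^ 2 - phi (- q) ^ 2) / 4"
proof -
  have q2: "norm (q ^ 2) < 1" using q by simp
  have s: "phi q ^ 2 + phi (- q) ^ 2 = 2 * phi (q ^ 2) ^ 2"
    using q phi_square_parity[of q] by (cases "q = 0") auto
  have l4: "phi_ld (- q) = phi_ld q - (phi q ^ 4 - phi (- q) ^ 4) / 4"
    using phi_ld_diff[OF q] phi_pow4_diff[OF q] by (simp add: algebra_simps)
  have "phi (q ^ 2) ^ 2 * (2 * phi_ld (q ^ 2)) =
        phi (q ^ 2) ^ 2 * (phi_ld q - phi (- q) ^ 2 * (phi q ^ 2 - phi (- q) ^ 2) / 4)"
    using phi_ld_sum_weighted[OF q] s unfolding l4 by algebra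
  then show ?thesis using phi_nonzero[OF q2] by simp
qed

text \<open>If \<open>g\<close> were nonzero somewhere, it would be so on an open set, where
  \<open>f\<close> then vanishes, and \<open>f\<close> would be 0 throughout the disc. The puncture
  admits identities obtained after division by \<open>q\<close>.\<close>

lemma holomorphic_mult_eq_0:
  fixes f g :: "complex \<Rightarrow> complex"
  assumes f: "f holomorphic_on ball 0 1" and g: "g holomorphic_on ball 0 1" and f0: "norm a < 1" "f a \<noteq> 0"
    and fg: "\<And>q. norm q < 1 \<Longrightarrow> q \<noteq> 0 \<Longrightarrow> f q * g q = 0" and q: "norm q < 1"
  shows "g q = 0"
proof (rule ccontr)
  assume g0: "g q \<noteq> 0"
  have "f w = 0" if w: "w \<in> ball 0 1" for w
  proof -
    have "continuous_on (ball 0 1) g"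
      using g by (rule holomorphic_on_imp_continuous_on)
    then have o: "open {x \<in> ball 0 1. g x \<noteq> 0}"
      using continuous_open_preimage[of "ball 0 1" g "- {0}"]
      by (simp add: vimage_def Int_def open_Compl)
    then have oS: "open ({x \<in> ball 0 1. g x \<noteq> 0} - {0})" (is "open ?S") by (rule open_delete)
    have neS: "?S \<noteq> {}"
    proof
      assume "?S = {}"
      then have "{x \<in> ball 0 1. g x \<noteq> 0} = {0}" using g0 q by auto
      with o show False
        by (metis not_open_singleton)
    qed
    show "f w = 0"
    proof (rule analytic_continuation_open[of ?S "ball 0 1" f "\<lambda>_. 0"])
      show "f x = 0" if "x \<in> ?S" for x
        using fg[of x] that by simp
    qed (use f w oS neS in auto)
  qed
  then show False using f0 by auto
qed

text \<open>The defect satisfies \<open>4 * H (q ^ 2) = H q\<close>, so \<open>K = H / q\<close>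
  satisfies \<open>K q = 4 * q * K (q ^ 2)\<close>. This is a contraction near 0 and forces
  \<open>K = 0\<close>.\<close>

lemma deriv_phi_ld:
  assumes q: "norm q < 1"
  shows "q * deriv phi_ld q = 2 * phi_ld q ^ 2 + 2 * q * psi q ^ 4 * phi (- q) ^ 4"
proof -
  define K where "K q = deriv phi_ld q - 2 * q * (deriv phi q / phi q) ^ 2 - 2 * psi q ^ 4 * phi (- q) ^ 4" for q
  define H where "H q = q * deriv phi_ld q - 2 * phi_ld q ^ 2 - 2 * q * psi q ^ 4 * phi (- q) ^ 4" for q
  have H: "H q = q * K q" for q
    by (simp add: H_def K_def phi_ld_def algebra_simps power2_eq_square)
  \<comment> \<open>Jacobi's identity removes \<open>psi\<close>, so that everything can be
    expressed by \<open>y\<close>, \<open>t\<close> and \<open>L\<close> below.\<close>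
  have H_eq: "H q = q * deriv phi_ld q - 2 * phi_ld q ^ 2 - (phi q ^ 4 - phi (- q) ^ 4) * phi (- q) ^ 4 / 8"
    if "norm q < 1" for q
    using phi_pow4_diff[OF that] by (simp add: H_def)
  have step: "4 * H (q ^ 2) = H q" if q: "norm q < 1" for q
  proof -
    have q2: "norm (q ^ 2) < 1" and qm: "norm (- q) < 1" using q by auto
    define y t where "y = phi q ^ 2" and "t = phi (- q) ^ 2"
    define L where "L = phi_ld q"
    have l4: "phi_ld (- q) = L - (y ^ 2 - t ^ 2) / 4"
      using phi_ld_diff[OF q] phi_pow4_diff[OF q] by (simp add: L_def y_def t_def algebra_simps)
    have e: "a * a ^ 2 = a ^ 3" for a :: complex
      by (simp add: power2_eq_square power3_eq_cube)
    have "8 * (deriv phi_ld (q ^ 2) * (2 * q)) = 4 * deriv phi_ld q -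
        ((2 * phi (- q) * (- deriv phi (- q))) * (phi q ^ 2 - phi (- q) ^ 2) +
         phi (- q) ^ 2 * (2 * phi q * deriv phi q - 2 * phi (- q) * (- deriv phi (- q))))"
    proof (rule has_field_derivative_unique_on_open[of "ball 0 1" q "\<lambda>q. 8 * phi_ld (q ^ 2)"
            "\<lambda>q. 4 * phi_ld q - phi (- q) ^ 2 * (phi q ^ 2 - phi (- q) ^ 2)"])
      show "8 * phi_ld (q ^ 2) = 4 * phi_ld q - phi (- q) ^ 2 * (phi q ^ 2 - phi (- q) ^ 2)"
        if "q \<in> ball 0 1" for q
        using that phi_ld_square[of q] by (simp add: field_simps)
    qed (use q in \<open>auto intro!: derivative_eq_intros simp: algebra_simps e\<close>)
    then have "16 * (q ^ 2 * deriv phi_ld (q ^ 2)) = 4 * (q * deriv phi_ld q) -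
        ((2 * phi (- q) * ((- q) * deriv phi (- q))) * (phi q ^ 2 - phi (- q) ^ 2) +
         phi (- q) ^ 2 * (2 * phi q * (q * deriv phi q) - 2 * phi (- q) * ((- q) * deriv phi (- q))))"
      by algebra
    then have d: "16 * (q ^ 2 * deriv phi_ld (q ^ 2)) = 4 * (q * deriv phi_ld q) -
        (2 * t * (L - (y ^ 2 - t ^ 2) / 4) * (y - t) +
         t * (2 * y * L - 2 * t * (L - (y ^ 2 - t ^ 2) / 4)))"
      unfolding deriv_phi_eq[OF q] deriv_phi_eq[OF qm] l4 L_def [symmetric] y_def t_def
      by algebra
    have s: "phi (q ^ 2) ^ 4 = ((y + t) / 2) ^ 2"
    proof -
      have "y + t = 2 * phi (q ^ 2) ^ 2"
        unfolding y_def t_def using q phi_square_parity[of q] by (cases "q = 0") auto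
      then show ?thesis by simp
    qed
    have m: "phi (- (q ^ 2)) ^ 4 = y * t"
      using phi_mult_phi_minus[OF q] unfolding y_def t_def by algebra
    have l: "phi_ld (q ^ 2) = (L - t * (y - t) / 4) / 2"
      using phi_ld_square[OF q] unfolding L_def y_def t_def by (simp add: mult.commute)
    have p4: "phi q ^ 4 = y ^ 2" "phi (- q) ^ 4 = t ^ 2" by (simp_all add: y_def t_def)
    show ?thesis
    proof -
      define A B where "A = q ^ 2 * deriv phi_ld (q ^ 2)" and "B = q * deriv phi_ld q"
      have e: "A = (4 * B - (2 * t * (L - (y ^ 2 - t ^ 2) / 4) * (y - t) +
          t * (2 * y * L - 2 * t * (L - (y ^ 2 - t ^ 2) / 4)))) / 16"
        unfolding A_def B_def by (subst d [symmetric]) simp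
      show ?thesis
        unfolding H_eq[OF q] H_eq[OF q2] s m l p4 L_def [symmetric]
          A_def [symmetric] B_def [symmetric]
        by (simp only: e) (simp add: field_simps eval_nat_numeral)
    qed
  qed
  have K: "K holomorphic_on ball 0 1"
    unfolding K_def
    by (intro holomorphic_intros holomorphic_theta holomorphic_phi_ld
          holomorphic_comp_ball[OF holomorphic_theta(4)]) (auto simp: phi_nonzero)
  have K_step: "4 * q * K (q ^ 2) = K q" if "norm q < 1" "q \<noteq> 0" for q
    using step[OF that(1)] that(2) unfolding H by (simp add: power2_eq_square mult.assoc)
  have "K q = 0" if "norm q < 1" for q
  proof -
    have "continuous_on (cball 0 (1 / 8)) K"
      using holomorphic_on_imp_continuous_on[OF K] by (rule continuous_on_subset) auto
    then obtain u where u: "norm u \<le> 1 / 8" "\<And>x. norm x \<le> 1 / 8 \<Longrightarrow> norm (K x) \<le> norm (K u)"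
      using continuous_attains_sup[OF compact_cball _ continuous_on_norm, of 0 "1 / 8" K] by auto
    \<comment> \<open>The radius 1/8 makes the factor \<open>4 * norm x\<close> at most 1/2, and
      squaring stays inside the disc.\<close>
    have half: "norm (K x) \<le> norm (K u) / 2" if x: "norm x \<le> 1 / 8" "x \<noteq> 0" for x
    proof -
      have "norm (x ^ 2) \<le> 1 / 8"
        using mult_mono[of "norm x" "1 / 8" "norm x" 1] x by (simp add: norm_mult power2_eq_square)
      have "norm (K x) = norm (4 * x * K (x ^ 2))"
        using K_step[of x] x by simp
      also have "\<dots> = 4 * norm x * norm (K (x ^ 2))"
        by (simp add: norm_mult)
      also have "\<dots> \<le> 1 / 2 * norm (K u)"
        by (intro mult_mono u) (use x \<open>norm (x ^ 2) \<le> 1 / 8\<close> in auto)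
      finally show ?thesis by simp
    qed
    have z: "K x = 0" if x: "x \<in> ball 0 (1 / 8) - {0}" for x
    proof (cases "u = 0")
      case False
      then have "K u = 0" using half[of u] u(1) by auto
      then show ?thesis using u(2)[of x] x by auto
    next
      case True
      \<comment> \<open>If the maximum sits at 0, where the recursion was divided out, the bound by
        half the maximum passes to the limit.\<close>
      have "((\<lambda>x. norm (K x)) \<longlongrightarrow> norm (K 0)) (at 0)"
        using K by (intro tendsto_norm)
          (meson analytic_at analytic_at_imp_isCont centre_in_ball isCont_def open_ball zero_less_one)
      moreover have "\<forall>\<^sub>F x in at 0. norm (K x) \<le> norm (K u) / 2"
        unfolding eventually_at
        by (intro exI[of _ "1 / 8"] conjI ballI impI half) auto
      ultimately have "norm (K 0) \<le> norm (K u) / 2"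
        by (intro tendsto_upperbound) auto
      then have "K u = 0" using True by auto
      then show ?thesis using u(2)[of x] x by auto
    qed
    have "open (ball 0 (1 / 8) - {0 :: complex})" by (intro open_delete open_ball)
    moreover have "complex_of_real (1 / 16) \<in> ball 0 (1 / 8) - {0}" by simp
    ultimately show ?thesis
      using analytic_continuation_open[of "ball 0 (1 / 8) - {0}" "ball 0 1" K "\<lambda>_. 0" q] K z that
      by fastforce
  qed
  then have "H q = 0" using q unfolding H by simp
  then show ?thesis unfolding H_def by (simp add: algebra_simps)
qed

section \<open>Relations of level five\<close>

text \<open>In the notation \<open>s_i\<close> of the introduction, \<open>phi5 q = s_3\<close>,
  \<open>phi5 (- q) = s_4\<close> and \<open>psi5 q / q = s_2\<close>. Leaving out the
  \<open>1 / q\<close> keeps \<open>psi5\<close> holomorphic at 0.\<close>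

definition phi5 :: "complex \<Rightarrow> complex" where "phi5 q = phi q / phi (q ^ 5)"
definition psi5 :: "complex \<Rightarrow> complex" where "psi5 q = psi q / psi (q ^ 5)"

lemma phi5_0 [simp]: "phi5 0 = 1" and psi5_0 [simp]: "psi5 0 = 1"
  by (simp_all add: phi5_def psi5_def)

lemma holomorphic_phi5: "phi5 holomorphic_on ball 0 1"
  and holomorphic_psi5: "psi5 holomorphic_on ball 0 1"
  unfolding phi5_def [abs_def] psi5_def [abs_def]
  by (intro holomorphic_intros holomorphic_theta
      holomorphic_comp_ball[OF holomorphic_theta(4)] holomorphic_comp_ball[OF holomorphic_theta(5)];
      simp add: phi_nonzero psi_nonzero)+

lemmas phi5_deriv [derivative_intros] = has_field_derivative_comp_ball[OF holomorphic_phi5]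
  and psi5_deriv [derivative_intros] = has_field_derivative_comp_ball[OF holomorphic_psi5]

lemma phi5_nonzero: "norm q < 1 \<Longrightarrow> phi5 q \<noteq> 0"
  by (simp add: phi5_def phi_nonzero)

text \<open>Each ratio of thetas is \<open>e * r_i ^ 2\<close>, and by Euler's identity the
  \<open>r_i\<close> multiply to 1. The quintic identities become formulas for
  \<open>s_i ^ 2 - 1\<close> that are linear in \<open>r_i\<close>.\<close>

lemma quintic_product_forms:
  fixes q :: complex
  assumes q: "norm q < 1" "q \<noteq> 0"
  defines "e \<equiv> euler2 q / euler2 (q ^ 5)"
    and "r2 \<equiv> p2 q / p2 (q ^ 5)" and "r3 \<equiv> p3 q / p3 (q ^ 5)" and "r4 \<equiv> p3 (- q) / p3 (- (q ^ 5))"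
  shows "psi5 q = e * r2 ^ 2" "phi5 q = e * r3 ^ 2" "phi5 (- q) = e * r4 ^ 2"
    and "r2 * r3 * r4 = 1" "p2 (q ^ 5) * p3 (q ^ 5) * p3 (- (q ^ 5)) = 1"
    and "(phi5 q ^ 2 - 1) * p3 (q ^ 5) ^ 4 = 4 * q * r3"
    and "(phi5 (- q) ^ 2 - 1) * p3 (- (q ^ 5)) ^ 4 = - 4 * q * r4"
    and "(psi5 q ^ 2 - q ^ 2) * p2 (q ^ 5) ^ 4 = r2"
    and "r3 \<noteq> 0"
proof -
  have q5: "norm (q ^ 5) < 1" and q5m: "norm (- (q ^ 5)) < 1" and qm: "norm (- q) < 1" "- q \<noteq> 0"
    using q by auto
  note nz = euler2_nonzero[OF q5] p2_nonzero[OF q5] p3_nonzero[OF q5] p3_nonzero[OF q5m]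
    euler2_nonzero[OF q(1)] p2_nonzero[OF q(1)] p3_nonzero[OF q(1)] p3_nonzero[OF qm(1)]
    phi_nonzero[OF q5] phi_nonzero[OF q5m] psi_nonzero[OF q5]
  show "psi5 q = e * r2 ^ 2" "phi5 q = e * r3 ^ 2" "phi5 (- q) = e * r4 ^ 2"
    by (simp_all add: psi5_def phi5_def psi_def phi_def e_def r2_def r3_def r4_def power_divide)
  show "r2 * r3 * r4 = 1"
    using p_product[OF q(1)] p_product[OF q5] by (simp add: r2_def r3_def r4_def mult_ac)
  show "p2 (q ^ 5) * p3 (q ^ 5) * p3 (- (q ^ 5)) = 1"
    by (rule p_product[OF q5])
  show "r3 \<noteq> 0"
    using nz by (simp add: r3_def)
  \<comment> \<open>One computation serves three cases: a quintic identity is divided by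
    \<open>euler2 (q ^ 5) ^ 2 * c\<close>, with \<open>c\<close> the relevant product at
    \<open>q ^ 5\<close>.\<close>
  have cancel: "A * c ^ 4 = B * r"
    if "f ^ 2 * c = g ^ 2 * k * c + B * euler2 (q ^ 5) ^ 2 * h" "A = (f / g) ^ 2 - k" "g = euler2 (q ^ 5) * c ^ 2"
      "r * c = h" "c \<noteq> 0" for A B f g k h r c :: complex
  proof -
    have "g \<noteq> 0" using that nz by auto
    then have "A * g ^ 2 = f ^ 2 - k * g ^ 2" using that(2) by (simp add: field_simps)
    then have "(c * euler2 (q ^ 5) ^ 2) * (A * c ^ 4) = (c * euler2 (q ^ 5) ^ 2) * (B * r)"
      using that(1,3,4) by algebra
    then show ?thesis using that(5) nz by simp
  qed
  show "(phi5 q ^ 2 - 1) * p3 (q ^ 5) ^ 4 = 4 * q * r3"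
    by (rule cancel[of "phi q" _ "phi (q ^ 5)" 1 _ "p3 q"])
       (use nz phi_square_quintic[OF q] in \<open>simp_all add: r3_def phi_def phi5_def\<close>)
  show "(phi5 (- q) ^ 2 - 1) * p3 (- (q ^ 5)) ^ 4 = - 4 * q * r4"
    by (rule cancel[of "phi (- q)" _ "phi (- (q ^ 5))" 1 _ "p3 (- q)"])
       (use nz phi_square_quintic[OF qm] in \<open>simp_all add: r4_def phi_def phi5_def\<close>)
  show "(psi5 q ^ 2 - q ^ 2) * p2 (q ^ 5) ^ 4 = r2"
    using cancel[of "psi q" "p2 (q ^ 5)" "psi (q ^ 5)" "q ^ 2" 1 "p2 q" "psi5 q ^ 2 - q ^ 2" r2]
      nz psi_square_quintic[OF q] by (simp add: r2_def psi_def psi5_def mult_ac)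
qed

lemma phi5_square_neq_1:
  assumes q: "norm q < 1" "q \<noteq> 0"
  shows "phi5 q ^ 2 \<noteq> 1"
  using quintic_product_forms(6,9)[OF q] q by auto

text \<open>Multiplying the three formulas for \<open>s_i ^ 2 - 1\<close>, all auxiliary products
  cancel by Euler's identity at \<open>q\<close> and at \<open>q ^ 5\<close>.\<close>

lemma quintic_product:
  assumes q: "norm q < 1" "q \<noteq> 0"
  shows "(phi5 q ^ 2 - 1) * (phi5 (- q) ^ 2 - 1) * (psi5 q ^ 2 - q ^ 2) = - 16 * q ^ 2"
proof -
  define a b c where "a = p2 (q ^ 5)" and "b = p3 (q ^ 5)" and "c = p3 (- (q ^ 5))"
  define r2 r3 r4 where "r2 = p2 q / p2 (q ^ 5)"
    and "r3 = p3 q / p3 (q ^ 5)" and "r4 = p3 (- q) / p3 (- (q ^ 5))"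
  note F = quintic_product_forms(4-8)[OF q, folded r2_def r3_def r4_def, folded a_def b_def c_def]
  have "(phi5 q ^ 2 - 1) * (phi5 (- q) ^ 2 - 1) * (psi5 q ^ 2 - q ^ 2) * (a * b * c) ^ 4 =
     ((phi5 q ^ 2 - 1) * b ^ 4) * ((phi5 (- q) ^ 2 - 1) * c ^ 4) * ((psi5 q ^ 2 - q ^ 2) * a ^ 4)"
    by (simp add: power_mult_distrib mult_ac)
  also have "\<dots> = - 16 * q ^ 2 * (r2 * r3 * r4)"
    unfolding F(3-5) by (simp add: power2_eq_square)
  finally show ?thesis
    unfolding F(1,2) by simp
qed

text \<open>Divided by its Euler product, Jacobi's identity at \<open>q ^ 5\<close> is
  \<open>b ^ 8 - c ^ 8 = 16 * q ^ 5 * a ^ 8\<close>. The squared formulas for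
  \<open>s_i ^ 2 - 1\<close> replace these eighth powers, giving \<open>s_3 / (s_3^2 - 1)^2 = s_4 /
  (s_4^2 - 1)^2 + s_2 / (s_2^2 - 1)^2\<close>.\<close>

lemma quintic_jacobi:
  assumes q: "norm q < 1" "q \<noteq> 0"
  shows "phi5 q * (phi5 (- q) ^ 2 - 1) ^ 2 * (psi5 q ^ 2 - q ^ 2) ^ 2
       = phi5 (- q) * (phi5 q ^ 2 - 1) ^ 2 * (psi5 q ^ 2 - q ^ 2) ^ 2
       + q ^ 3 * psi5 q * (phi5 q ^ 2 - 1) ^ 2 * (phi5 (- q) ^ 2 - 1) ^ 2"
proof -
  note F = quintic_product_forms[OF q]
  define a b c where "a = p2 (q ^ 5)" and "b = p3 (q ^ 5)" and "c = p3 (- (q ^ 5))"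
  define e r2 r3 r4 where "e = euler2 q / euler2 (q ^ 5)" and "r2 = p2 q / p2 (q ^ 5)"
    and "r3 = p3 q / p3 (q ^ 5)" and "r4 = p3 (- q) / p3 (- (q ^ 5))"
  define A B C where "A = psi5 q ^ 2 - q ^ 2" and "B = phi5 q ^ 2 - 1" and "C = phi5 (- q) ^ 2 - 1"
  note F' = F[folded a_def b_def c_def e_def r2_def r3_def r4_def, folded A_def B_def C_def]
  have q5: "norm (q ^ 5) < 1" using q by simp
  have "(b ^ 8 - c ^ 8) * euler2 (q ^ 5) ^ 4 = 16 * q ^ 5 * a ^ 8 * euler2 (q ^ 5) ^ 4"
    using phi_pow4_diff[OF q5]
    by (simp add: phi_def psi_def a_def b_def c_def power_mult_distrib algebra_simps flip: power_mult)
  then have J: "b ^ 8 - c ^ 8 = 16 * q ^ 5 * a ^ 8"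
    using euler2_nonzero[OF q5] by simp
  have nz: "a \<noteq> 0" "b \<noteq> 0" "c \<noteq> 0"
    using F'(5) by auto
  have eq: "B ^ 2 * b ^ 8 = 16 * q ^ 2 * r3 ^ 2" "C ^ 2 * c ^ 8 = 16 * q ^ 2 * r4 ^ 2"
    "A ^ 2 * a ^ 8 = r2 ^ 2"
    using arg_cong[OF F'(6), of "\<lambda>x. x ^ 2"] arg_cong[OF F'(7), of "\<lambda>x. x ^ 2"]
      arg_cong[OF F'(8), of "\<lambda>x. x ^ 2"] by (simp_all add: power_mult_distrib flip: power_mult)
  have "16 * q ^ 2 * (e * r3 ^ 2 * C ^ 2 * A ^ 2) = e * A ^ 2 * B ^ 2 * C ^ 2 * b ^ 8"
    using eq(1) by algebra
  moreover have "16 * q ^ 2 * (e * r4 ^ 2 * B ^ 2 * A ^ 2) = e * A ^ 2 * B ^ 2 * C ^ 2 * c ^ 8"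
    using eq(2) by algebra
  moreover have "16 * q ^ 2 * (q ^ 3 * (e * r2 ^ 2) * B ^ 2 * C ^ 2) =
      e * A ^ 2 * B ^ 2 * C ^ 2 * (16 * q ^ 5 * a ^ 8)"
    using eq(3) by algebra
  ultimately have "16 * q ^ 2 * (e * r3 ^ 2 * C ^ 2 * A ^ 2) =
      16 * q ^ 2 * (e * r4 ^ 2 * B ^ 2 * A ^ 2 + q ^ 3 * (e * r2 ^ 2) * B ^ 2 * C ^ 2)"
    using J by algebra
  then have "e * r3 ^ 2 * C ^ 2 * A ^ 2 =
      e * r4 ^ 2 * B ^ 2 * A ^ 2 + q ^ 3 * (e * r2 ^ 2) * B ^ 2 * C ^ 2"
    using q by simp
  then show ?thesis
    unfolding F'(1-3) [symmetric] A_def B_def C_def .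
qed

text \<open>Here \<open>4 \<Sum> x / (x\<^sup>2 - 1)\<^sup>2 = \<Sum> 1 / (1 - x)\<^sup>2 - \<Sum> 1 / (1 + x)\<^sup>2\<close>, and both sums are polynomials in
  \<open>1 / n\<close> or \<open>1 / p\<close>, \<open>S\<close> and \<open>\<sigma>\<close>. After multiplication by \<open>S - 8\<close> the factor \<open>d\<close> splits off,
  because \<open>d\<^sup>2 = (S - 8) (S + 8)\<close>.\<close>

lemma triple_relation_factor:
  fixes x y w :: complex
  defines "p \<equiv> (1 + x) * (1 + y) * (1 + w)" and "n \<equiv> (1 - x) * (1 - y) * (1 - w)"
    and "\<sigma> \<equiv> x + y + w"
  assumes pn: "p * n = 16"
    and rel: "x * (y ^ 2 - 1) ^ 2 * (w ^ 2 - 1) ^ 2 + y * (x ^ 2 - 1) ^ 2 * (w ^ 2 - 1) ^ 2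
        + w * (x ^ 2 - 1) ^ 2 * (y ^ 2 - 1) ^ 2 = 0"
  defines "S \<equiv> p + n" and "d \<equiv> n - p"
  shows "d * (16 * S * (S - 8) * \<sigma> ^ 2 + 8 * d * \<sigma> * (S ^ 2 - 4 * S - 16)
            + (S - 8) * (S * (S + 4) ^ 2 - 384)) = 0"
proof -
  have *: "d * (16 * S * (S - 8) * \<sigma> ^ 2 + 8 * d * \<sigma> * (S ^ 2 - 4 * S - 16)
            + (S - 8) * (S * (S + 4) ^ 2 - 384)) = 0"
    if "p * n = 16" "S = p + n" "d = n - p"
      "p ^ 2 * ((4 + S - 4 * \<sigma>) ^ 2 - 8 * (3 - \<sigma>) * n) - n ^ 2 * ((4 + S + 4 * \<sigma>) ^ 2 - 8 * (3 + \<sigma>) * p) = 0"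
    for p n \<sigma> S d :: complex
  proof -
    have "d ^ 2 = S ^ 2 - 4 * (p * n)"
      unfolding that(2,3) by algebra
    then have d2: "d ^ 2 = (S - 8) * (S + 8)"
      unfolding that(1) by (simp add: power2_eq_square algebra_simps)
    have "16 * d * S * \<sigma> ^ 2 + 8 * ((S + 4) * (S ^ 2 - 2 * (p * n)) - p * n * S) * \<sigma>
        + d * (S * (S + 4) ^ 2 - 24 * (p * n)) = 0"
      using that(4) unfolding that(2,3) by algebra
    then have "16 * d * S * \<sigma> ^ 2 + 8 * (S + 8) * (S ^ 2 - 4 * S - 16) * \<sigma> + d * (S * (S + 4) ^ 2 - 384) = 0"
      unfolding that(1) by (simp add: power2_eq_square algebra_simps)
    then show ?thesis using d2 by algebra
  qed
  \<comment> \<open>The elementary symmetric functions of \<open>1 - x\<close>,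
    \<open>1 - y\<close>, \<open>1 - w\<close> are \<open>3 - \<sigma>\<close>,
    \<open>(4 + S - 4 * \<sigma>) / 2\<close> and \<open>n\<close>, which yields the sum of the
    \<open>1 / (1 - x) ^ 2\<close>; changing signs exchanges \<open>n\<close> and \<open>p\<close>.
    The left side is \<open>4 * p ^ 2 * n ^ 2\<close> times the difference of the two sums.\<close>
  have "p ^ 2 * ((4 + S - 4 * \<sigma>) ^ 2 - 8 * (3 - \<sigma>) * n) - n ^ 2 * ((4 + S + 4 * \<sigma>) ^ 2 - 8 * (3 + \<sigma>) * p) =
     16 * (x * (y ^ 2 - 1) ^ 2 * (w ^ 2 - 1) ^ 2 + y * (x ^ 2 - 1) ^ 2 * (w ^ 2 - 1) ^ 2
        + w * (x ^ 2 - 1) ^ 2 * (y ^ 2 - 1) ^ 2)"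
    unfolding S_def p_def n_def \<sigma>_def by algebra
  then show ?thesis
    using *[of p n S d \<sigma>] pn rel by (simp add: S_def d_def)
qed

section \<open>Solving the two relations between the level-five ratios\<close>

lemma phi5_has_derivative_0: "(phi5 has_field_derivative 2) (at 0)"
proof -
  have "((\<lambda>q. phi q / phi (q ^ 5)) has_field_derivative 2) (at 0)"
    by (auto intro!: derivative_eq_intros simp: deriv_phi_0)
  then show ?thesis by (simp add: phi5_def [abs_def])
qed

text \<open>For the two triple products \<open>p\<close> and \<open>n\<close>, the first relation
  says \<open>p = n\<close> and the second \<open>p + n = - 8\<close>. Both come from a product of
  holomorphic functions being 0, the behaviour at 0 excluding the wrong factor.\<close>

lemma quintic_relations:
  assumes q: "norm q < 1"
  shows "psi5 q + q * (phi5 (- q) - phi5 q) = psi5 q * phi5 q * phi5 (- q)"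
    and "psi5 q * (phi5 (- q) - phi5 q) - q * phi5 q * phi5 (- q) = - 5 * q"
proof -
  define g where "g q = phi5 (- q) - phi5 q" for q
  define D where "D q = psi5 q + q * g q - psi5 q * phi5 q * phi5 (- q)" for q
  define sg where "sg q = psi5 q + q * g q" for q
  define T where "T q = 2 * q + 2 * (psi5 q * g q - q * phi5 q * phi5 (- q))" for q
  define K where "K q = 16 * T q * (T q - 8 * q) * sg q ^ 2
      - 16 * D q * sg q * (T q ^ 2 - 4 * q * T q - 16 * q ^ 2)
      + (T q - 8 * q) * (T q * (T q + 4 * q) ^ 2 - 384 * q ^ 3)" for q
  \<comment> \<open>In \<open>triple_relation_factor\<close> with \<open>x = psi5 q / q\<close>, \<open>y = phi5 (- q)\<close>, \<open>w = - phi5 q\<close> one has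
    \<open>q d = - 2 D\<close>, \<open>q \<sigma> = sg\<close> and \<open>q S = T\<close>; \<open>K\<close> is \<open>q\<^sup>4\<close> times the cofactor of \<open>d\<close>. Near \<open>q = 0\<close> the
    cofactor grows like \<open>2048 / q\<^sup>2\<close>, so \<open>D\<close> vanishes identically.\<close>
  note hol = holomorphic_intros holomorphic_phi5 holomorphic_psi5 holomorphic_comp_ball[OF holomorphic_phi5]
  have g: "g holomorphic_on ball 0 1"
    unfolding g_def by (intro hol; simp)
  have D: "D holomorphic_on ball 0 1"
    unfolding D_def by (intro hol g; simp)
  have sg: "sg holomorphic_on ball 0 1"
    unfolding sg_def by (intro hol g; simp)
  have T: "T holomorphic_on ball 0 1"
    unfolding T_def by (intro hol g; simp)
  have K: "K holomorphic_on ball 0 1"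
    unfolding K_def by (intro hol g D sg T)
  have tend: "(f \<longlongrightarrow> f 0) (at 0)" if "f holomorphic_on ball 0 1" for f :: "complex \<Rightarrow> complex"
    using that by (meson analytic_at analytic_at_imp_isCont centre_in_ball isCont_def open_ball zero_less_one)
  have "(g has_field_derivative - 4) (at 0)"
    unfolding g_def
    by (auto intro!: derivative_eq_intros simp: DERIV_imp_deriv[OF phi5_has_derivative_0])
  then have g_lim: "((\<lambda>q. g q / q) \<longlongrightarrow> - 4) (at 0)"
    by (simp add: has_field_derivative_iff g_def)
  have phm: "((\<lambda>q. phi5 (- q)) \<longlongrightarrow> 1) (at 0)"
  proof -
    have "(\<lambda>q. phi5 (- q)) holomorphic_on ball 0 1"
      by (intro hol; simp)
    from tend[OF this] show ?thesis by simp
  qed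
  have lims: "(psi5 \<longlongrightarrow> 1) (at 0)" "(phi5 \<longlongrightarrow> 1) (at 0)" "(D \<longlongrightarrow> 0) (at 0)" "(sg \<longlongrightarrow> 1) (at 0)"
    using tend[OF holomorphic_psi5] tend[OF holomorphic_phi5] tend[OF D] tend[OF sg]
    by (simp_all add: D_def sg_def g_def)
  define t where "t q = 2 + 2 * (psi5 q * (g q / q) - phi5 q * phi5 (- q))" for q
  have t: "T q = q * t q" if "q \<noteq> 0" for q
    using that by (simp add: T_def t_def field_simps)
  \<comment> \<open>The limit \<open>- 8\<close> of \<open>p + n\<close> decides the sign of the
    common value of \<open>p\<close> and \<open>n\<close>.\<close>
  have t_lim: "(t \<longlongrightarrow> 2 + 2 * (1 * - 4 - 1 * 1)) (at 0)"
    unfolding t_def by (intro tendsto_intros lims g_lim phm)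
  then have t_lim: "(t \<longlongrightarrow> - 8) (at 0)" by simp
  have ball_ev: "\<forall>\<^sub>F q in at (0::complex). norm q < 1 \<and> q \<noteq> 0"
    unfolding eventually_at by (intro exI[of _ 1]) auto
  define k where "k q = 16 * t q * (t q - 8) * sg q ^ 2 - 16 * D q * sg q * (t q ^ 2 - 4 * t q - 16)
      + q ^ 2 * (t q - 8) * (t q * (t q + 4) ^ 2 - 384)" for q
  have k: "K q = q ^ 2 * k q" if "q \<noteq> 0" for q
    unfolding K_def k_def t[OF that] by algebra
  have "(k \<longlongrightarrow> 16 * (- 8) * (- 8 - 8) * 1 ^ 2 - 16 * 0 * 1 * ((- 8) ^ 2 - 4 * (- 8) - 16)
      + 0 ^ 2 * (- 8 - 8) * (- 8 * (- 8 + 4) ^ 2 - 384)) (at 0)"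
    unfolding k_def by (intro tendsto_intros lims t_lim)
  then have "(k \<longlongrightarrow> 2048) (at 0)" by simp
  then have "\<forall>\<^sub>F q in at 0. k q \<noteq> 0"
    by (rule tendsto_imp_eventually_ne) simp
  with ball_ev have "\<forall>\<^sub>F q in at 0. norm q < 1 \<and> q \<noteq> 0 \<and> k q \<noteq> 0"
    by eventually_elim auto
  from eventually_happens'[OF at_neq_bot this]
  obtain a where a: "norm a < 1" "a \<noteq> 0" "k a \<noteq> 0" by blast
  have "((\<lambda>q. t q - 8) \<longlongrightarrow> - 8 - 8) (at 0)"
    by (intro tendsto_intros t_lim)
  then have "\<forall>\<^sub>F q in at 0. t q - 8 \<noteq> 0"
    by (rule tendsto_imp_eventually_ne) simp
  with ball_ev have "\<forall>\<^sub>F q in at 0. norm q < 1 \<and> q \<noteq> 0 \<and> t q - 8 \<noteq> 0"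
    by eventually_elim auto
  from eventually_happens'[OF at_neq_bot this]
  obtain b where b: "norm b < 1" "b \<noteq> 0" "t b - 8 \<noteq> 0" by blast
  have pn: "(1 + psi5 q / q) * (1 + phi5 (- q)) * (1 - phi5 q) *
      ((1 - psi5 q / q) * (1 - phi5 (- q)) * (1 + phi5 q)) = 16" if q: "norm q < 1" "q \<noteq> 0" for q
  proof -
    have "q ^ 2 * ((1 + psi5 q / q) * (1 - psi5 q / q)) = q ^ 2 - psi5 q ^ 2"
      using q by (simp add: field_simps power2_eq_square)
    then have "q ^ 2 * ((1 + psi5 q / q) * (1 + phi5 (- q)) * (1 - phi5 q) *
      ((1 - psi5 q / q) * (1 - phi5 (- q)) * (1 + phi5 q))) = q ^ 2 * 16"
      using quintic_product[OF q] by algebra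
    then show ?thesis using q by simp
  qed
  have DK: "K q * D q = 0" if q: "norm q < 1" "q \<noteq> 0" for q
  proof -
    define x y s where "x = psi5 q / q" and "y = phi5 (- q)" and "s = phi5 q"
    have xq: "psi5 q = q * x" using q by (simp add: x_def)
    have rel0: "x * (y ^ 2 - 1) ^ 2 * ((- s) ^ 2 - 1) ^ 2 + y * (x ^ 2 - 1) ^ 2 * ((- s) ^ 2 - 1) ^ 2
        + (- s) * (x ^ 2 - 1) ^ 2 * (y ^ 2 - 1) ^ 2 = 0"
    proof -
      have "q ^ 4 * (x * (y ^ 2 - 1) ^ 2 * ((- s) ^ 2 - 1) ^ 2 + y * (x ^ 2 - 1) ^ 2 * ((- s) ^ 2 - 1) ^ 2
        + (- s) * (x ^ 2 - 1) ^ 2 * (y ^ 2 - 1) ^ 2) = 0"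
        using quintic_jacobi[OF q] unfolding xq y_def [symmetric] s_def [symmetric] by algebra
      then show ?thesis using q by simp
    qed
    define p n where "p = (1 + x) * (1 + y) * (1 + - s)" and "n = (1 - x) * (1 - y) * (1 - - s)"
    have "p * n = 16"
      using pn[OF q] unfolding x_def y_def s_def p_def n_def by simp
    then have "(n - p) * (16 * (p + n) * (p + n - 8) * (x + y + - s) ^ 2
        + 8 * (n - p) * (x + y + - s) * ((p + n) ^ 2 - 4 * (p + n) - 16)
        + (p + n - 8) * ((p + n) * (p + n + 4) ^ 2 - 384)) = 0"
      unfolding p_def n_def by (intro triple_relation_factor rel0)
    moreover have "p + n = t q"
      unfolding p_def n_def t_def g_def xq using q unfolding y_def s_def by (simp add: field_simps)
    moreover have "q * (n - p) = - 2 * D q"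
      unfolding p_def n_def D_def g_def xq y_def [symmetric] s_def [symmetric] by algebra
    moreover have "sg q = q * (x + y + - s)"
      unfolding sg_def g_def xq y_def [symmetric] s_def [symmetric] by algebra
    ultimately show ?thesis
      unfolding K_def t[OF q(2)] by algebra
  qed
  have D0: "D q = 0" if "norm q < 1" for q
    by (rule holomorphic_mult_eq_0[OF K D a(1) _ DK that]) (use a k in auto)
  then show "psi5 q + q * (phi5 (- q) - phi5 q) = psi5 q * phi5 q * phi5 (- q)"
    using q by (simp add: D_def g_def)
  \<comment> \<open>With \<open>p = n\<close>, the product 16 leaves only \<open>p + n = 8\<close>
    or \<open>p + n = - 8\<close>.\<close>
  have TT: "(T q - 8 * q) * (T q + 8 * q) = 0" if q: "norm q < 1" "q \<noteq> 0" for q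
  proof -
    define p n where "p = (1 + psi5 q / q) * (1 + phi5 (- q)) * (1 - phi5 q)"
      and "n = (1 - psi5 q / q) * (1 - phi5 (- q)) * (1 + phi5 q)"
    have "q * (n - p) = - 2 * D q"
      unfolding p_def n_def D_def g_def using q by (simp add: field_simps)
    then have "n = p" using D0[OF q(1)] q by simp
    moreover have "p * n = 16" unfolding p_def n_def by (rule pn[OF q])
    moreover have "T q = q * (p + n)"
      unfolding t[OF q(2)] p_def n_def t_def g_def using q by (simp add: field_simps)
    ultimately have "(T q - 8 * q) * (T q + 8 * q) = 4 * q ^ 2 * (p * p) - 64 * q ^ 2" "p * p = 16"
      by (simp_all add: algebra_simps power2_eq_square)
    then show ?thesis by simp
  qed
  have "T q + 8 * q = 0"
  proof (rule holomorphic_mult_eq_0[of "\<lambda>q. T q - 8 * q" "\<lambda>q. T q + 8 * q" b])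
    show "T b - 8 * b \<noteq> 0"
    proof
      assume "T b - 8 * b = 0"
      then have "b * (t b - 8) = 0" using t[OF b(2)] by (simp add: algebra_simps)
      then show False using b by simp
    qed
  qed (use b TT q in \<open>auto intro!: hol T\<close>)
  then have "2 * (psi5 q * (phi5 (- q) - phi5 q) - q * phi5 q * phi5 (- q)) = 2 * (- 5 * q)"
    unfolding T_def g_def by algebra
  then show "psi5 q * (phi5 (- q) - phi5 q) - q * phi5 q * phi5 (- q) = - 5 * q"
    unfolding mult_cancel_left by simp
qed

section \<open>Parametrization of \<open>X\<close> and \<open>Z\<close>\<close>

text \<open>Substituting \<open>s_2 + s_4 = s_3 (1 + s_2 s_4)\<close> into
  \<open>s_2 s_4 - s_3 (s_2 + s_4) = - 5\<close> eliminates the sum and leaves the product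
  \<open>s_2 s_4\<close>.\<close>

lemma quintic_modulus:
  assumes q: "norm q < 1"
  shows "psi5 q * phi5 (- q) * (phi5 q ^ 2 - 1) = q * (5 - phi5 q ^ 2)"
  using quintic_relations[OF q] by algebra

lemma Z_nonzero: "norm q < 1 \<Longrightarrow> Z q \<noteq> 0"
  by (simp add: Z_eq phi_nonzero)

text \<open>The Euler products cancel in \<open>z / Z\<close>, leaving
  \<open>X = q / (r3 ^ 4 * b ^ 8)\<close>. The formula for \<open>m - 1\<close> removes
  \<open>b\<close>, and \<open>quintic_modulus\<close> removes \<open>e\<close>.\<close>

lemma X_phi5:
  assumes q: "norm q < 1"
  shows "16 * phi5 q ^ 2 * X q = (5 - phi5 q ^ 2) * (phi5 q ^ 2 - 1)"
proof (cases "q = 0")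
  case True
  then show ?thesis by (simp add: X_def z_eq)
next
  case False
  define b where "b = p3 (q ^ 5)"
  define e r2 r3 r4 where "e = euler2 q / euler2 (q ^ 5)" and "r2 = p2 q / p2 (q ^ 5)"
    and "r3 = p3 q / p3 (q ^ 5)" and "r4 = p3 (- q) / p3 (- (q ^ 5))"
  note F = quintic_product_forms[OF q False, folded b_def e_def r2_def r3_def r4_def]
  have q5: "norm (q ^ 5) < 1" using q by simp
  note nz = euler2_nonzero[OF q] p3_nonzero[OF q] euler2_nonzero[OF q5] p3_nonzero[OF q5]
  define m where "m = phi5 q ^ 2"
  have "X q * (p3 q ^ 4 * b ^ 4) = q"
    using nz by (simp add: X_def z_eq[OF q] Z_eq[OF q] phi_def b_def power_mult_distrib flip: power_mult)
  moreover have "p3 q = r3 * b" using nz by (simp add: r3_def b_def)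
  ultimately have X: "X q * r3 ^ 4 * b ^ 8 = q" by (simp add: power_mult_distrib mult_ac flip: power_add)
  have M: "(m - 1) * b ^ 4 = 4 * q * r3" using F(6) by (simp add: m_def)
  have "e ^ 2 * (m - 1) * (r2 * r3 * r4) ^ 2 = q * (5 - m) * r3 ^ 2"
    using quintic_modulus[OF q] unfolding m_def [symmetric] F(1,3) by algebra
  then have P: "e ^ 2 * (m - 1) = q * (5 - m) * r3 ^ 2" unfolding F(4) by simp
  have m: "m = e ^ 2 * r3 ^ 4" unfolding m_def F(2) by (simp add: power_mult_distrib flip: power_mult)
  have "q * r3 ^ 2 * b ^ 8 * (16 * m * X q) = 16 * q * e ^ 2 * r3 ^ 2 * (X q * r3 ^ 4 * b ^ 8)"
    using m by algebra
  also have "\<dots> = e ^ 2 * ((m - 1) * b ^ 4) ^ 2"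
    unfolding X M by algebra
  also have "\<dots> = e ^ 2 * (m - 1) * (m - 1) * b ^ 8"
    by algebra
  also have "\<dots> = q * r3 ^ 2 * b ^ 8 * ((5 - m) * (m - 1))"
    unfolding P by algebra
  finally have "q * r3 ^ 2 * b ^ 8 * (16 * m * X q) = q * r3 ^ 2 * b ^ 8 * ((5 - m) * (m - 1))" .
  then show ?thesis
    using False nz F(9) by (simp add: m_def b_def)
qed

text \<open>These are the inhomogeneous terms of \<open>deriv_phi_ld\<close> at \<open>q ^ 5\<close>
  and at \<open>q\<close>, expressed by \<open>Z\<close> and \<open>m\<close>.\<close>

lemma psi_pow4_Z:
  assumes q: "norm q < 1" "q \<noteq> 0"
  shows "4096 * phi5 q ^ 6 * (q ^ 5 * psi (q ^ 5) ^ 4 * phi (- (q ^ 5)) ^ 4)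
         = Z q ^ 2 * (phi5 q ^ 2 - 1) ^ 5 * (5 - phi5 q ^ 2)"
    and "4096 * phi5 q ^ 6 * (q * psi q ^ 4 * phi (- q) ^ 4)
         = Z q ^ 2 * (phi5 q ^ 2 - 1) * (5 - phi5 q ^ 2) ^ 5"
proof -
  define a b c where "a = p2 (q ^ 5)" and "b = p3 (q ^ 5)" and "c = p3 (- (q ^ 5))"
  define e r2 r3 r4 where "e = euler2 q / euler2 (q ^ 5)" and "r2 = p2 q / p2 (q ^ 5)"
    and "r3 = p3 q / p3 (q ^ 5)" and "r4 = p3 (- q) / p3 (- (q ^ 5))"
  note F = quintic_product_forms[OF q, folded a_def b_def c_def e_def r2_def r3_def r4_def]
  have q5: "norm (q ^ 5) < 1" "norm (- (q ^ 5)) < 1" using q by auto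
  define m where "m = phi5 q ^ 2"
  define E where "E = euler2 (q ^ 5)"
  have th: "psi (q ^ 5) = E * a ^ 2" "phi (q ^ 5) = E * b ^ 2" "phi (- (q ^ 5)) = E * c ^ 2"
    by (simp_all add: psi_def phi_def E_def a_def b_def c_def)
  have nz: "b \<noteq> 0" using F(5) by auto
  have M: "(m - 1) * b ^ 4 = 4 * q * r3" using F(6) by (simp add: m_def)
  have "e ^ 2 * (m - 1) * (r2 * r3 * r4) ^ 2 = q * (5 - m) * r3 ^ 2"
    using quintic_modulus[OF q(1)] unfolding m_def [symmetric] F(1,3) by algebra
  then have P: "e ^ 2 * (m - 1) = q * (5 - m) * r3 ^ 2" unfolding F(4) by simp
  have m: "m = e ^ 2 * r3 ^ 4" unfolding m_def F(2) by (simp add: power_mult_distrib flip: power_mult)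
  have "q * r3 ^ 2 * (b ^ 4 * r3 ^ 5 * (5 - m)) = r3 ^ 5 * e ^ 2 * ((m - 1) * b ^ 4)"
    using P by algebra
  also have "\<dots> = q * r3 ^ 2 * (4 * m)" unfolding M using m by algebra
  finally have m4: "4 * m = b ^ 4 * r3 ^ 5 * (5 - m)"
    using q F(9) by simp
  have M5: "(m - 1) ^ 5 * b ^ 20 = 1024 * q ^ 5 * r3 ^ 5"
    using arg_cong[OF M, of "\<lambda>x. x ^ 5"] by (simp add: power_mult_distrib flip: power_mult)
  have Z: "Z q = E ^ 4 * b ^ 8 * m"
  proof -
    have "phi q = phi5 q * phi (q ^ 5)" using phi_nonzero[OF q5(1)] by (simp add: phi5_def)
    then show ?thesis unfolding Z_eq[OF q(1)] th m_def by algebra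
  qed
  have "b ^ 8 * (4096 * m ^ 3 * (q ^ 5 * (E * a ^ 2) ^ 4 * (E * c ^ 2) ^ 4)) =
        4096 * m ^ 3 * q ^ 5 * E ^ 8 * (a * b * c) ^ 8"
    by algebra
  also have "\<dots> = 1024 * q ^ 5 * m ^ 2 * E ^ 8 * (4 * m)"
    unfolding F(5) power_one mult_1_right by algebra
  also have "\<dots> = m ^ 2 * E ^ 8 * (1024 * q ^ 5 * r3 ^ 5) * b ^ 4 * (5 - m)"
    unfolding m4 by algebra
  also have "\<dots> = b ^ 8 * ((E ^ 4 * b ^ 8 * m) ^ 2 * (m - 1) ^ 5 * (5 - m))"
    unfolding M5 [symmetric] by algebra
  finally have "4096 * m ^ 3 * (q ^ 5 * psi (q ^ 5) ^ 4 * phi (- (q ^ 5)) ^ 4) =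
      Z q ^ 2 * (m - 1) ^ 5 * (5 - m)"
    unfolding Z th using nz by simp
  then have 1: "4096 * phi5 q ^ 6 * (q ^ 5 * psi (q ^ 5) ^ 4 * phi (- (q ^ 5)) ^ 4) =
      Z q ^ 2 * (m - 1) ^ 5 * (5 - m)"
    by (simp add: m_def flip: power_mult)
  then show "4096 * phi5 q ^ 6 * (q ^ 5 * psi (q ^ 5) ^ 4 * phi (- (q ^ 5)) ^ 4)
         = Z q ^ 2 * (phi5 q ^ 2 - 1) ^ 5 * (5 - phi5 q ^ 2)"
    by (simp add: m_def)
  \<comment> \<open>The second term is \<open>(s_2 s_4) ^ 4\<close> times the first, and
    \<open>s_2 s_4 = (5 - m) / (m - 1)\<close>.\<close>
  define u y where "u = psi5 q" and "y = phi5 (- q)"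
  have py: "psi q = u * psi (q ^ 5)" "phi (- q) = y * phi (- (q ^ 5))"
    using psi_nonzero[OF q5(1)] phi_nonzero[OF q5(2)] by (simp_all add: u_def y_def psi5_def phi5_def)
  have "u * y * (m - 1) = q * (5 - m)"
    using quintic_modulus[OF q(1)] by (simp add: u_def y_def m_def)
  then have uy: "(u * y) ^ 4 * (m - 1) ^ 4 = q ^ 4 * (5 - m) ^ 4"
    by (metis power_mult_distrib)
  have "q ^ 4 * (m - 1) ^ 4 * (4096 * phi5 q ^ 6 * (q * psi q ^ 4 * phi (- q) ^ 4)) =
        (u * y) ^ 4 * (m - 1) ^ 4 * (4096 * phi5 q ^ 6 * (q ^ 5 * psi (q ^ 5) ^ 4 * phi (- (q ^ 5)) ^ 4))"
    unfolding py by algebra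
  also have "\<dots> = q ^ 4 * (m - 1) ^ 4 * (Z q ^ 2 * (m - 1) * (5 - m) ^ 5)"
    unfolding uy 1 by algebra
  finally show "4096 * phi5 q ^ 6 * (q * psi q ^ 4 * phi (- q) ^ 4)
         = Z q ^ 2 * (phi5 q ^ 2 - 1) * (5 - phi5 q ^ 2) ^ 5"
    using q phi5_square_neq_1[OF q] by (simp add: m_def)
qed

section \<open>Logarithmic derivatives of the ratios, and the derivative of \<open>X\<close>\<close>

text \<open>Obtained by differentiating Jacobi's quartic identity. The \<open>- 1 / 4\<close>
  reflects the factor \<open>q^(1/4)\<close> by which \<open>\<theta>_2\<close> exceeds
  \<open>2 psi\<close>.\<close>

lemma deriv_psi_eq:
  assumes q: "norm q < 1"
  shows "q * deriv psi q = psi q * (phi_ld q + (phi (- q) ^ 4 - 1) / 4)"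
proof (cases "q = 0")
  case False
  have qm: "norm (- q) < 1" using q by simp
  have "4 * phi q ^ 3 * deriv phi q - 4 * phi (- q) ^ 3 * (- deriv phi (- q)) =
        16 * psi q ^ 4 + 16 * q * (4 * psi q ^ 3 * deriv psi q)"
  proof (rule has_field_derivative_unique_on_open[of "ball 0 1" q "\<lambda>q. phi q ^ 4 - phi (- q) ^ 4"
        "\<lambda>q. 16 * q * psi q ^ 4"])
    show "phi q ^ 4 - phi (- q) ^ 4 = 16 * q * psi q ^ 4" if "q \<in> ball 0 1" for q
      using that by (intro phi_pow4_diff) simp
  qed (use q in \<open>auto intro!: derivative_eq_intros\<close>)
  then have d: "4 * phi q ^ 3 * (q * deriv phi q) - 4 * phi (- q) ^ 3 * ((- q) * deriv phi (- q)) =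
        16 * q * psi q ^ 4 + 64 * q * psi q ^ 3 * (q * deriv psi q)"
    by algebra
  have p: "phi q ^ 4 = phi (- q) ^ 4 + 16 * q * psi q ^ 4"
    using phi_pow4_diff[OF q] by (simp add: algebra_simps)
  have l: "phi_ld (- q) = phi_ld q - 4 * q * psi q ^ 4"
    using phi_ld_diff[OF q] by (simp add: algebra_simps)
  have "64 * q * psi q ^ 3 * (q * deriv psi q) =
        64 * q * psi q ^ 3 * (psi q * (phi_ld q + (phi (- q) ^ 4 - 1) / 4))"
    using d p unfolding deriv_phi_eq[OF q] deriv_phi_eq[OF qm] l by algebra
  then show ?thesis using False psi_nonzero[OF q] by simp
qed (simp add: phi_ld_def)

definition phi5_ld :: "complex \<Rightarrow> complex" where
  "phi5_ld q = phi_ld q - 5 * phi_ld (q ^ 5)"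

lemma deriv_phi5_eq:
  assumes q: "norm q < 1"
  shows "q * deriv phi5 q = phi5 q * phi5_ld q"
proof -
  have q5: "norm (q ^ 5) < 1" using q by simp
  have "deriv phi5 q * phi (q ^ 5) + phi5 q * (deriv phi (q ^ 5) * (5 * q ^ 4)) = deriv phi q"
  proof (rule has_field_derivative_unique_on_open[of "ball 0 1" q "\<lambda>q. phi5 q * phi (q ^ 5)" phi])
    show "phi5 x * phi (x ^ 5) = phi x" if "x \<in> ball 0 1" for x
      using that by (simp add: phi5_def phi_nonzero)
  qed (use q in \<open>auto intro!: derivative_eq_intros\<close>)
  then have "q * (deriv phi5 q * phi (q ^ 5) + phi5 q * (deriv phi (q ^ 5) * (5 * q ^ 4))) = q * deriv phi q"
    by (simp only:)
  moreover have "q ^ 5 = q * q ^ 4" by (simp flip: power_Suc)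
  ultimately have "(q * deriv phi5 q) * phi (q ^ 5) + 5 * phi5 q * (q ^ 5 * deriv phi (q ^ 5)) = q * deriv phi q"
    by (simp add: algebra_simps)
  moreover have "phi q = phi5 q * phi (q ^ 5)" using phi_nonzero[OF q5] by (simp add: phi5_def)
  ultimately have "phi (q ^ 5) * (q * deriv phi5 q) = phi (q ^ 5) * (phi5 q * phi5_ld q)"
    unfolding deriv_phi_eq[OF q] deriv_phi_eq[OF q5] phi5_ld_def by algebra
  then show ?thesis using phi_nonzero[OF q5] by simp
qed

lemma deriv_psi5_eq:
  assumes q: "norm q < 1"
  shows "q * deriv psi5 q = psi5 q * (phi5_ld (- q) + 1 + (phi q ^ 4 - 5 * phi (q ^ 5) ^ 4) / 4)"
proof -
  have q5: "norm (q ^ 5) < 1" using q by simp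
  \<comment> \<open>The formula is recast with \<open>phi_ld (- q)\<close>, so that
    \<open>psi5 q / q\<close> is compared with \<open>phi5 (- q)\<close>, its symmetric partner in
    the quintic relations. The constants \<open>- 1 / 4\<close> and \<open>5 / 4\<close> later add
    up to the 1.\<close>
  have ld: "q * deriv psi q = psi q * (phi_ld (- q) + (phi q ^ 4 - 1) / 4)" if q: "norm q < 1" for q
  proof -
    have "phi_ld q + (phi (- q) ^ 4 - 1) / 4 = phi_ld (- q) + (phi q ^ 4 - 1) / 4"
      using phi_ld_diff[OF q] phi_pow4_diff[OF q] by algebra
    then show ?thesis using deriv_psi_eq[OF q] by simp
  qed
  have "deriv psi5 q * psi (q ^ 5) + psi5 q * (deriv psi (q ^ 5) * (5 * q ^ 4)) = deriv psi q"
  proof (rule has_field_derivative_unique_on_open[of "ball 0 1" q "\<lambda>q. psi5 q * psi (q ^ 5)" psi])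
    show "psi5 x * psi (x ^ 5) = psi x" if "x \<in> ball 0 1" for x
      using that by (simp add: psi5_def psi_nonzero)
  qed (use q in \<open>auto intro!: derivative_eq_intros\<close>)
  then have "q * (deriv psi5 q * psi (q ^ 5) + psi5 q * (deriv psi (q ^ 5) * (5 * q ^ 4))) = q * deriv psi q"
    by (simp only:)
  moreover have "q ^ 5 = q * q ^ 4" by (simp flip: power_Suc)
  ultimately have "(q * deriv psi5 q) * psi (q ^ 5) + 5 * psi5 q * (q ^ 5 * deriv psi (q ^ 5)) = q * deriv psi q"
    by (simp add: algebra_simps)
  moreover have "psi q = psi5 q * psi (q ^ 5)" using psi_nonzero[OF q5] by (simp add: psi5_def)
  ultimately have "psi (q ^ 5) * (q * deriv psi5 q) =
      psi (q ^ 5) * (psi5 q * (phi5_ld (- q) + 1 + (phi q ^ 4 - 5 * phi (q ^ 5) ^ 4) / 4))"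
    unfolding ld[OF q] ld[OF q5] phi5_ld_def by simp algebra
  then show ?thesis using psi_nonzero[OF q5] by simp
qed

text \<open>Here \<open>l2, l3, l4\<close> are the logarithmic derivatives of \<open>x, s, y\<close>, so that \<open>d1\<close> and \<open>d2\<close> are the derivatives
  of \<open>x + y = s (1 + x y)\<close> and \<open>x y - s (x + y) = - 5\<close>.\<close>

lemma quintic_tangent:
  fixes x y s l2 l3 l4 B :: complex
  assumes c1: "x + y = s * (1 + x * y)" and c2: "x * y * (s ^ 2 - 1) = 5 - s ^ 2"
    and d1: "x * l2 + y * l4 - s * l3 = x * s * y * (l2 + l3 + l4)"
    and d2: "x * y * (l2 + l4) = s * x * (l2 + l3) + s * y * (l3 + l4)"
    and B: "4 * (l2 - l4) = B * (s ^ 4 - 5)"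
  shows "(s ^ 4 - 5) * (256 * s ^ 2 * l3 ^ 2
         - B ^ 2 * (s ^ 4 - 2 * s ^ 2 + 5) * (5 - s ^ 2) ^ 2 * (s ^ 2 - 1) ^ 2) = 0"
proof -
  \<comment> \<open>The relations are symmetric under exchanging \<open>x, l2\<close> with
    \<open>y, l4\<close>, so sums and differences are used: \<open>h1\<close> expresses the sum
    \<open>a\<close> by \<open>l3\<close>, and then \<open>h2\<close> the product
    \<open>d * b\<close>.\<close>
  define p a b d m where "p = x * y" and "a = l2 + l4" and "b = l2 - l4" and "d = x - y" and "m = s ^ 2"
  have p1: "p * (m - 1) = 5 - m" "(1 + p) * (m - 1) = 4"
    using c2 by (simp_all add: p_def m_def algebra_simps)
  have e: "x * l2 + y * l4 = s * l3 * (1 + p) + p * s * a"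
    using d1 unfolding p_def a_def by algebra
  have "p * a = s * (x * l2 + y * l4) + s * (x + y) * l3"
    using d2 unfolding p_def a_def by algebra
  then have h1: "p * a * (m - 1) = - 2 * m * l3 * (1 + p)"
    unfolding e c1 m_def p_def by algebra
  have "d * b = 2 * (x * l2 + y * l4) - (x + y) * a"
    unfolding d_def a_def b_def by algebra
  then have h2: "d * b = 2 * s * l3 * (1 + p) + s * a * (p - 1)"
    unfolding e c1 p_def by algebra
  have "d * b * (p * (m - 1)) = 2 * s * l3 * (1 + p) * (m - p)"
    using h1 h2 by algebra
  then have "d * b * (p * (m - 1)) * (m - 1) ^ 2 =
      2 * s * l3 * ((1 + p) * (m - 1)) * (m * (m - 1) - p * (m - 1))"
    by algebra
  then have h3: "d * b * (5 - m) * (m - 1) ^ 2 = 8 * s * l3 * (m ^ 2 - 5)"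
    unfolding p1 by algebra
  have "4 * b = B * (m ^ 2 - 5)"
    using B by (simp add: b_def m_def)
  \<comment> \<open>Both sides contain \<open>m ^ 2 - 5\<close>, which may vanish here, so the
    factor stays in the conclusion.\<close>
  then have h4: "(m ^ 2 - 5) * (d * B * (5 - m) * (m - 1) ^ 2 - 32 * s * l3) = 0"
    using h3 by algebra
  have "d ^ 2 = (x + y) ^ 2 - 4 * p"
    unfolding d_def p_def by algebra
  then have "d ^ 2 * (m - 1) ^ 2 = m * ((1 + p) * (m - 1)) ^ 2 - 4 * (p * (m - 1)) * (m - 1)"
    unfolding c1 m_def p_def by algebra
  then have d2: "d ^ 2 * (m - 1) ^ 2 = 4 * (m ^ 2 - 2 * m + 5)"
    unfolding p1 by (simp add: algebra_simps power2_eq_square)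
  \<comment> \<open>Multiplying by the conjugate leaves only \<open>d ^ 2\<close>, a rational
    function of \<open>m\<close>.\<close>
  have "(m ^ 2 - 5) * (B ^ 2 * (d ^ 2 * (m - 1) ^ 2) * (5 - m) ^ 2 * (m - 1) ^ 2 - 1024 * m * l3 ^ 2) = 0"
    using arg_cong[OF h4, of "\<lambda>r. r * (d * B * (5 - m) * (m - 1) ^ 2 + 32 * s * l3)"]
    unfolding m_def by algebra
  then have "- 4 * ((m ^ 2 - 5) * (256 * m * l3 ^ 2 - B ^ 2 * (m ^ 2 - 2 * m + 5) * (5 - m) ^ 2 * (m - 1) ^ 2)) = 0"
    unfolding d2 by algebra
  then have "(m ^ 2 - 5) * (256 * m * l3 ^ 2 - B ^ 2 * (m ^ 2 - 2 * m + 5) * (5 - m) ^ 2 * (m - 1) ^ 2) = 0"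
    by (metis mult_eq_0_iff neg_equal_0_iff_equal zero_neq_numeral)
  then show ?thesis
    by (simp add: m_def)
qed

lemma holomorphic_phi5_ld: "phi5_ld holomorphic_on ball 0 1"
  unfolding phi5_ld_def [abs_def]
  by (intro holomorphic_intros holomorphic_phi_ld holomorphic_comp_ball[OF holomorphic_phi_ld]; simp)

lemma phi5_ld_square:
  assumes q: "norm q < 1"
  shows "256 * phi5 q ^ 2 * phi5_ld q ^ 2 =
         phi (q ^ 5) ^ 8 * (phi5 q ^ 4 - 2 * phi5 q ^ 2 + 5) * (5 - phi5 q ^ 2) ^ 2 * (phi5 q ^ 2 - 1) ^ 2"
proof -
  define F where "F q = 256 * phi5 q ^ 2 * phi5_ld q ^ 2
     - (phi (q ^ 5) ^ 4) ^ 2 * (phi5 q ^ 4 - 2 * phi5 q ^ 2 + 5) * (5 - phi5 q ^ 2) ^ 2 * (phi5 q ^ 2 - 1) ^ 2" for q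
  have "F q = 0"
  \<comment> \<open>The factor left by \<open>quintic_tangent\<close> is \<open>- 4\<close> at the
    origin, hence not identically 0.\<close>
  proof (rule holomorphic_mult_eq_0[of "\<lambda>q. phi5 q ^ 4 - 5" F 0])
    show "(\<lambda>q. phi5 q ^ 4 - 5) holomorphic_on ball 0 1"
      by (intro holomorphic_intros holomorphic_phi5)
    show "F holomorphic_on ball 0 1"
      unfolding F_def
      by (intro holomorphic_intros holomorphic_phi5 holomorphic_phi5_ld
          holomorphic_comp_ball[OF holomorphic_theta(4)]; simp)
  next
    fix q :: complex assume q: "norm q < 1" "q \<noteq> 0"
    have qm: "norm (- q) < 1" and q5: "norm (q ^ 5) < 1" using q by auto
    define x y s l3 l4 where "x = psi5 q / q" and "y = phi5 (- q)" and "s = phi5 q"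
      and "l3 = phi5_ld q" and "l4 = phi5_ld (- q)"
    define b where "b = (phi q ^ 4 - 5 * phi (q ^ 5) ^ 4) / 4"
    have u: "psi5 q = q * x" using q by (simp add: x_def)
    have ds: "q * deriv phi5 q = s * l3"
      using deriv_phi5_eq[OF q(1)] by (simp add: s_def l3_def)
    have dy: "(- q) * deriv phi5 (- q) = y * l4"
      using deriv_phi5_eq[OF qm] by (simp only: y_def l4_def)
    \<comment> \<open>\<open>l4 + b\<close> is the logarithmic derivative of
      \<open>x = psi5 q / q\<close> and takes the place of \<open>l2\<close>; the extra 1 belongs to
      the factor \<open>q\<close>.\<close>
    have du: "q * deriv psi5 q = q * x * (l4 + b + 1)"
      using deriv_psi5_eq[OF q(1)] unfolding u l4_def b_def by (simp add: add_ac)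
    have "q * (x + y) = q * (s * (1 + x * y))"
      using quintic_relations(1)[OF q(1)] unfolding u y_def [symmetric] s_def [symmetric] by algebra
    then have c1: "x + y = s * (1 + x * y)" using q by simp
    have "q * (x * y * (s ^ 2 - 1)) = q * (5 - s ^ 2)"
      using quintic_modulus[OF q(1)] unfolding u y_def [symmetric] s_def [symmetric] by algebra
    then have c2: "x * y * (s ^ 2 - 1) = 5 - s ^ 2" using q by simp
    have "deriv psi5 q + (1 * (phi5 (- q) - phi5 q) + q * (- deriv phi5 (- q) - deriv phi5 q)) =
        (deriv psi5 q * phi5 q + psi5 q * deriv phi5 q) * phi5 (- q) + psi5 q * phi5 q * (- deriv phi5 (- q))"
      by (rule has_field_derivative_unique_on_open[of "ball 0 1" q
            "\<lambda>q. psi5 q + q * (phi5 (- q) - phi5 q)" "\<lambda>q. psi5 q * phi5 q * phi5 (- q)"])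
         (use q quintic_relations(1) in \<open>auto intro!: derivative_eq_intros simp: algebra_simps\<close>)
    then have "q * deriv psi5 q + (q * (y - s) + q * ((- q) * deriv phi5 (- q) - q * deriv phi5 q)) =
        (q * deriv psi5 q) * s * y + q * x * (q * deriv phi5 q) * y + q * x * s * ((- q) * deriv phi5 (- q))"
      unfolding u y_def [symmetric] s_def [symmetric] by algebra
    then have "q * (x * (l4 + b) + y * l4 - s * l3) = q * (x * s * y * (l4 + b + l3 + l4))"
      unfolding ds dy du using c1 by algebra
    then have d1: "x * (l4 + b) + y * l4 - s * l3 = x * s * y * (l4 + b + l3 + l4)"
      using q by simp
    have "deriv psi5 q * (phi5 (- q) - phi5 q) + psi5 q * (- deriv phi5 (- q) - deriv phi5 q)
        - ((phi5 q + q * deriv phi5 q) * phi5 (- q) + q * phi5 q * (- deriv phi5 (- q))) = - 5"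
      by (rule has_field_derivative_unique_on_open[of "ball 0 1" q
            "\<lambda>q. psi5 q * (phi5 (- q) - phi5 q) - q * phi5 q * phi5 (- q)" "\<lambda>q. - 5 * q"])
         (use q quintic_relations(2) in \<open>auto intro!: derivative_eq_intros simp: algebra_simps\<close>)
    then have "(q * deriv psi5 q) * (y - s) + q * x * ((- q) * deriv phi5 (- q) - q * deriv phi5 q)
        - (q * s * y + q * (q * deriv phi5 q) * y + q * s * ((- q) * deriv phi5 (- q))) = - 5 * q"
      unfolding u y_def [symmetric] s_def [symmetric] by algebra
    moreover have "q * x * (y - s) - q * s * y = - 5 * q"
      using quintic_relations(2)[OF q(1)] unfolding u y_def [symmetric] s_def [symmetric] .
    ultimately have "q * (x * y * (l4 + b + l4)) = q * (s * x * (l4 + b + l3) + s * y * (l3 + l4))"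
      unfolding ds dy du by algebra
    then have d2: "x * y * (l4 + b + l4) = s * x * (l4 + b + l3) + s * y * (l3 + l4)"
      using q by simp
    have ph: "phi q = s * phi (q ^ 5)"
      using phi_nonzero[OF q5] by (simp add: s_def phi5_def)
    have B: "4 * (l4 + b - l4) = phi (q ^ 5) ^ 4 * (s ^ 4 - 5)"
    proof -
      have "4 * (l4 + b - l4) = phi q ^ 4 - 5 * phi (q ^ 5) ^ 4" by (simp add: b_def)
      then show ?thesis unfolding ph by (simp add: algebra_simps power_mult_distrib)
    qed
    show "(phi5 q ^ 4 - 5) * F q = 0"
      using quintic_tangent[OF c1 c2 d1 d2 B] unfolding F_def s_def l3_def .
  qed (use q in auto)
  then show ?thesis
    by (simp add: F_def flip: power_mult)
qed

lemma holomorphic_X: "X holomorphic_on ball 0 1"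
  and holomorphic_Z: "Z holomorphic_on ball 0 1"
proof -
  have Z: "(\<lambda>q. phi q ^ 2 * phi (q ^ 5) ^ 2) holomorphic_on ball 0 1"
    by (intro holomorphic_intros holomorphic_theta holomorphic_comp_ball[OF holomorphic_theta(4)]; simp)
  then show 1: "Z holomorphic_on ball 0 1"
    by (rule holomorphic_transform) (simp add: Z_eq)
  have "(\<lambda>q. q * euler2 q ^ 2 * euler2 (q ^ 5) ^ 2 / Z q) holomorphic_on ball 0 1"
    by (intro holomorphic_intros holomorphic_theta holomorphic_comp_ball[OF holomorphic_theta(1)] 1;
        simp add: Z_nonzero)
  then show "X holomorphic_on ball 0 1"
    by (rule holomorphic_transform) (simp add: X_def z_eq)
qed

lemma Z_phi5:
  assumes q: "norm q < 1"
  shows "Z q = phi (q ^ 5) ^ 4 * phi5 q ^ 2"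
proof -
  have "phi q = phi5 q * phi (q ^ 5)" using phi_nonzero[of "q ^ 5"] q by (simp add: phi5_def)
  then show ?thesis unfolding Z_eq[OF q] by algebra
qed

text \<open>Differentiating \<open>16 m X = (5 - m) (m - 1)\<close> gives
  \<open>16 m D X = 2 l (5 - m ^ 2)\<close>. After squaring, \<open>phi5_ld_square\<close> replaces
  \<open>l ^ 2\<close>.\<close>

lemma X_deriv_square:
  assumes q: "norm q < 1"
  shows "(q * deriv X q) ^ 2 = X q ^ 2 * Z q ^ 2 * ((1 - 4 * X q) * (1 - 12 * X q + 16 * X q ^ 2))"
proof -
  define s l m B where "s = phi5 q" and "l = phi5_ld q" and "m = s ^ 2" and "B = phi (q ^ 5) ^ 4"
  have s: "s \<noteq> 0" "m \<noteq> 0" using phi5_nonzero[OF q] by (auto simp: s_def m_def)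
  have X: "16 * m * X q = (5 - m) * (m - 1)"
    using X_phi5[OF q] by (simp add: m_def s_def)
  have l2: "256 * m * l ^ 2 = B ^ 2 * (m ^ 2 - 2 * m + 5) * (5 - m) ^ 2 * (m - 1) ^ 2"
    using phi5_ld_square[OF q] by (simp add: m_def s_def l_def B_def flip: power_mult)
  have "(32 * phi5 q * deriv phi5 q) * X q + 16 * phi5 q ^ 2 * deriv X q =
        - (2 * phi5 q * deriv phi5 q) * (phi5 q ^ 2 - 1) + (5 - phi5 q ^ 2) * (2 * phi5 q * deriv phi5 q)"
    by (rule has_field_derivative_unique_on_open[of "ball 0 1" q
          "\<lambda>q. 16 * phi5 q ^ 2 * X q" "\<lambda>q. (5 - phi5 q ^ 2) * (phi5 q ^ 2 - 1)"])
       (use q X_phi5 holomorphic_derivI[OF holomorphic_X]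
         in \<open>auto intro!: derivative_eq_intros simp: algebra_simps power2_eq_square power3_eq_cube\<close>)
  then have "32 * s * (q * deriv phi5 q) * X q + 16 * m * (q * deriv X q) =
        2 * s * (q * deriv phi5 q) * (6 - 2 * m)"
    unfolding m_def s_def by algebra
  then have "16 * m * (q * deriv X q) = 2 * m * l * (6 - 2 * m) - 2 * l * (16 * m * X q)"
    unfolding deriv_phi5_eq[OF q] m_def s_def l_def by algebra
  then have "16 * m * (q * deriv X q) = 2 * l * (5 - m ^ 2)"
    unfolding X by algebra
  then have "(16 * m * (q * deriv X q)) ^ 2 = (2 * l * (5 - m ^ 2)) ^ 2"
    by (simp only:)
  then have "64 * m * (16 * m * (q * deriv X q)) ^ 2 = (5 - m ^ 2) ^ 2 * (256 * m * l ^ 2)"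
    by algebra
  also have "\<dots> = B ^ 2 * (m ^ 2 - 5) ^ 2 * (m ^ 2 - 2 * m + 5) * ((5 - m) * (m - 1)) ^ 2"
    unfolding l2 by algebra
  also have "\<dots> = B ^ 2 * (m ^ 2 - 5) ^ 2 * (m ^ 2 - 2 * m + 5) * (16 * m * X q) ^ 2"
    unfolding X ..
  \<comment> \<open>The two polynomial factors come from here:
    \<open>m ^ 2 - 2 m + 5 = 4 m (1 - 4 X)\<close> and
    \<open>(m ^ 2 - 5) ^ 2 = 16 m ^ 2 (1 - 12 X + 16 X ^ 2)\<close>.\<close>
  also have "m ^ 2 - 2 * m + 5 = 4 * m - 16 * m * X q"
    unfolding X by algebra
  also have "(m ^ 2 - 5) ^ 2 = 16 * m ^ 2 - 12 * m * (16 * m * X q) + (16 * m * X q) ^ 2"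
    unfolding X by algebra
  finally have "16384 * m ^ 3 * (q * deriv X q) ^ 2 =
     16384 * m ^ 3 * (X q ^ 2 * (B * m) ^ 2 * ((1 - 4 * X q) * (1 - 12 * X q + 16 * X q ^ 2)))"
    by algebra
  then show ?thesis
    using s Z_phi5[OF q] by (simp add: m_def s_def B_def)
qed

section \<open>The second order equation for \<open>Z\<close> with respect to
  \<open>q d/dq\<close>\<close>

definition Z_ld :: "complex \<Rightarrow> complex" where
  "Z_ld q = 2 * phi_ld q + 10 * phi_ld (q ^ 5)"

lemma deriv_Z_eq:
  assumes q: "norm q < 1"
  shows "q * deriv Z q = Z_ld q * Z q"
proof -
  have q5: "norm (q ^ 5) < 1" using q by simp
  have "deriv Z q = 2 * phi q * deriv phi q * phi (q ^ 5) ^ 2 +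
       phi q ^ 2 * (2 * phi (q ^ 5) * (deriv phi (q ^ 5) * (5 * q ^ 4)))"
    by (rule has_field_derivative_unique_on_open[of "ball 0 1" q Z "\<lambda>q. phi q ^ 2 * phi (q ^ 5) ^ 2"])
       (use q Z_eq holomorphic_derivI[OF holomorphic_Z] in \<open>auto intro!: derivative_eq_intros\<close>)
  then have "q * deriv Z q = 2 * phi q * (q * deriv phi q) * phi (q ^ 5) ^ 2 +
       phi q ^ 2 * (10 * phi (q ^ 5) * (q ^ 5 * deriv phi (q ^ 5)))"
    by algebra
  then show ?thesis
    unfolding deriv_phi_eq[OF q] deriv_phi_eq[OF q5] Z_eq[OF q] Z_ld_def by algebra
qed

lemma holomorphic_Z_ld: "Z_ld holomorphic_on ball 0 1"
  unfolding Z_ld_def [abs_def]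
  by (intro holomorphic_intros holomorphic_phi_ld holomorphic_comp_ball[OF holomorphic_phi_ld]; simp)

text \<open>With \<open>L\<close> and \<open>M\<close> the values of \<open>phi_ld\<close> at
  \<open>q\<close> and \<open>q ^ 5\<close>, the quadratic terms combine to the perfect square
  \<open>4 (L - 5 M) ^ 2\<close>, and \<open>L - 5 M\<close> is \<open>phi5_ld q\<close>.\<close>

lemma Z_ld_equation:
  assumes q: "norm q < 1" "q \<noteq> 0"
  shows "2 * (q * deriv Z_ld q) - Z_ld q ^ 2 = Z q ^ 2 * (8 * X q - 80 * X q ^ 2 + 144 * X q ^ 3)"
proof -
  have q5: "norm (q ^ 5) < 1" using q by simp
  define s l m B where "s = phi5 q" and "l = phi5_ld q" and "m = s ^ 2" and "B = phi (q ^ 5) ^ 4"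
  have m: "m \<noteq> 0" using phi5_nonzero[OF q(1)] by (auto simp: s_def m_def)
  have X: "16 * m * X q = (5 - m) * (m - 1)"
    using X_phi5[OF q(1)] by (simp add: m_def s_def)
  have l2: "256 * m * l ^ 2 = B ^ 2 * (m ^ 2 - 2 * m + 5) * (5 - m) ^ 2 * (m - 1) ^ 2"
    using phi5_ld_square[OF q(1)] by (simp add: m_def s_def l_def B_def flip: power_mult)
  have Z: "Z q = B * m" using Z_phi5[OF q(1)] by (simp add: B_def m_def s_def)
  define t1 t2 where "t1 = q * psi q ^ 4 * phi (- q) ^ 4"
    and "t2 = q ^ 5 * psi (q ^ 5) ^ 4 * phi (- (q ^ 5)) ^ 4"
  have t: "4096 * m ^ 3 * t2 = Z q ^ 2 * (m - 1) ^ 5 * (5 - m)"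
    "4096 * m ^ 3 * t1 = Z q ^ 2 * (m - 1) * (5 - m) ^ 5"
    using psi_pow4_Z[OF q] by (simp_all add: m_def s_def t1_def t2_def flip: power_mult)
  have "deriv Z_ld q = 2 * deriv phi_ld q + 10 * (deriv phi_ld (q ^ 5) * (5 * q ^ 4))"
    by (rule has_field_derivative_unique_on_open[of "ball 0 1" q Z_ld "\<lambda>q. 2 * phi_ld q + 10 * phi_ld (q ^ 5)"])
       (use q Z_ld_def holomorphic_derivI[OF holomorphic_Z_ld] in \<open>auto intro!: derivative_eq_intros\<close>)
  then have "q * deriv Z_ld q = 2 * (q * deriv phi_ld q) + 50 * (q ^ 5 * deriv phi_ld (q ^ 5))"
    by algebra
  then have "2 * (q * deriv Z_ld q) - Z_ld q ^ 2 = 4 * l ^ 2 + 8 * (t1 + 25 * t2)"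
    unfolding deriv_phi_ld[OF q(1)] deriv_phi_ld[OF q5] Z_ld_def l_def phi5_ld_def t1_def t2_def
    by algebra
  then have "512 * m ^ 3 * (2 * (q * deriv Z_ld q) - Z_ld q ^ 2) =
     8 * m ^ 2 * (256 * m * l ^ 2) + 4096 * m ^ 3 * t1 + 25 * (4096 * m ^ 3 * t2)"
    by algebra
  also have "\<dots> = 512 * m ^ 3 * (Z q ^ 2 * (8 * X q - 80 * X q ^ 2 + 144 * X q ^ 3))"
  proof -
    \<comment> \<open>The polynomial in \<open>X\<close> is written in \<open>16 m X\<close>, so
      that the parametrization by \<open>m\<close> applies to each power.\<close>
    have "512 * m ^ 3 * (8 * X q - 80 * X q ^ 2 + 144 * X q ^ 3) =
       256 * m ^ 2 * (16 * m * X q) - 160 * m * (16 * m * X q) ^ 2 + 18 * (16 * m * X q) ^ 3"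
      by algebra
    then have "512 * m ^ 3 * (8 * X q - 80 * X q ^ 2 + 144 * X q ^ 3) =
       8 * (m ^ 2 - 2 * m + 5) * (5 - m) ^ 2 * (m - 1) ^ 2 + (m - 1) * (5 - m) ^ 5 + 25 * ((m - 1) ^ 5 * (5 - m))"
      unfolding X by algebra
    then show ?thesis
      unfolding l2 t Z by algebra
  qed
  finally show ?thesis using m by simp
qed

section \<open>The differential equation\<close>

lemma open_deriv_X_nonzero: "open {q. norm q < 1 \<and> deriv X q \<noteq> 0}"
proof -
  have "continuous_on (ball 0 1) (deriv X)"
    by (intro holomorphic_on_imp_continuous_on holomorphic_deriv holomorphic_X) auto
  then show ?thesis
    using continuous_open_preimage[of "ball 0 1" "deriv X" "- {0}"]
    by (simp add: vimage_def Int_def open_Compl)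
qed

lemma dX_eqI:
  assumes "open S" "q \<in> S" "\<And>x. x \<in> S \<Longrightarrow> g x = f x" "deriv X q \<noteq> 0"
    and "(g has_field_derivative c * deriv X q) (at q)"
  shows "dX f q = c"
proof -
  have "deriv f q = c * deriv X q"
    using has_field_derivative_transform_within_open[OF assms(5,1,2,3)] by (rule DERIV_imp_deriv)
  then show ?thesis using assms(4) by (simp add: dX_def)
qed

lemma has_field_derivative_dX:
  assumes "open S" "q \<in> S" "f holomorphic_on S" "deriv X q \<noteq> 0"
  shows "(f has_field_derivative dX f q * deriv X q) (at q)"
  using holomorphic_derivI[OF assms(3,1,2)] assms(4) by (simp add: dX_def)

lemma holomorphic_dX:
  assumes "open S" "f holomorphic_on S" "S \<subseteq> {q. norm q < 1 \<and> deriv X q \<noteq> 0}"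
  shows "dX f holomorphic_on S"
proof -
  have "X holomorphic_on S"
    using holomorphic_X by (rule holomorphic_on_subset) (use assms(3) in auto)
  then show ?thesis
    unfolding dX_def [abs_def] using assms by (intro holomorphic_intros) auto
qed

section \<open>The Riccati equation for \<open>V\<close>, and its derivative. On \<open>G\<close>
  the function \<open>X\<close> is a local coordinate\<close>

context
  fixes G :: "complex set" and V :: "complex \<Rightarrow> complex"
  defines "G \<equiv> {q. norm q < 1 \<and> deriv X q \<noteq> 0}"
    and "V \<equiv> (\<lambda>q. dX Z q / Z q)"
begin

lemma open_G: "open G"
  unfolding G_def by (rule open_deriv_X_nonzero)

lemma holomorphic_G:
  "X holomorphic_on G" "Z holomorphic_on G" "V holomorphic_on G" "dX V holomorphic_on G"
proof -
  have sub: "G \<subseteq> ball 0 1" by (auto simp: G_def)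
  show "X holomorphic_on G" and Z: "Z holomorphic_on G"
    using holomorphic_X holomorphic_Z sub by (auto intro: holomorphic_on_subset)
  show "V holomorphic_on G"
    unfolding V_def
    by (intro holomorphic_intros holomorphic_dX open_G Z) (auto simp: G_def Z_nonzero)
  then show "dX V holomorphic_on G"
    by (intro holomorphic_dX open_G) (auto simp: G_def)
qed

lemma G_deriv:
  assumes "q \<in> G"
  shows "(X has_field_derivative deriv X q) (at q)" "(Z has_field_derivative Z q * V q * deriv X q) (at q)"
    "(V has_field_derivative dX V q * deriv X q) (at q)"
    "(dX V has_field_derivative dX (dX V) q * deriv X q) (at q)"
proof -
  have q: "deriv X q \<noteq> 0" "Z q \<noteq> 0" using assms by (auto simp: G_def Z_nonzero)
  show "(X has_field_derivative deriv X q) (at q)"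
    by (rule holomorphic_derivI[OF holomorphic_G(1) open_G assms])
  show "(Z has_field_derivative Z q * V q * deriv X q) (at q)"
    using has_field_derivative_dX[OF open_G assms holomorphic_G(2) q(1)] q by (simp add: V_def)
  show "(V has_field_derivative dX V q * deriv X q) (at q)"
    by (rule has_field_derivative_dX[OF open_G assms holomorphic_G(3) q(1)])
  show "(dX V has_field_derivative dX (dX V) q * deriv X q) (at q)"
    by (rule has_field_derivative_dX[OF open_G assms holomorphic_G(4) q(1)])
qed

text \<open>With \<open>Y = D X\<close> one has \<open>V Y = D Z / Z\<close> and
  \<open>Y ^ 2 = Z ^ 2 h\<close>, where \<open>h = X ^ 2 (1 - 4 X) (1 - 12 X + 16 X ^ 2)\<close>.
  Differentiating both turns \<open>Z_ld_equation\<close> into an equation in \<open>X\<close>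
  alone, multiplied by \<open>Z ^ 2\<close>.\<close>

lemma riccati_punctured:
  assumes q: "q \<in> G" "q \<noteq> 0"
  shows "2 * (X q ^ 2 - 16 * X q ^ 3 + 64 * X q ^ 4 - 64 * X q ^ 5) * dX V q
       + (X q ^ 2 - 16 * X q ^ 3 + 64 * X q ^ 4 - 64 * X q ^ 5) * V q ^ 2
       + (2 * X q - 48 * X q ^ 2 + 256 * X q ^ 3 - 320 * X q ^ 4) * V q
       = 8 * X q - 80 * X q ^ 2 + 144 * X q ^ 3"
proof -
  define Y where "Y q = q * deriv X q" for q
  have hY: "Y holomorphic_on G"
    unfolding Y_def by (intro holomorphic_intros holomorphic_deriv holomorphic_G open_G)
  have nq: "norm q < 1" "deriv X q \<noteq> 0" using q by (auto simp: G_def)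
  define h h' where "h = X q ^ 2 - 16 * X q ^ 3 + 64 * X q ^ 4 - 64 * X q ^ 5"
    and "h' = 2 * X q - 48 * X q ^ 2 + 256 * X q ^ 3 - 320 * X q ^ 4"
  define y1 where "y1 = deriv Y q"
  have Y': "(Y has_field_derivative y1) (at q)"
    unfolding y1_def by (rule holomorphic_derivI[OF hY open_G q(1)])
  have VY: "V x * Y x = Z_ld x" if "x \<in> G" for x
  proof -
    have x: "norm x < 1" "deriv X x \<noteq> 0" using that by (auto simp: G_def)
    have "V x * Y x * Z x = x * deriv Z x"
      using x Z_nonzero[OF x(1)] by (simp add: V_def Y_def dX_def)
    then show ?thesis using deriv_Z_eq[OF x(1)] Z_nonzero[OF x(1)] by simp
  qed
  have Y2: "Y x ^ 2 = Z x ^ 2 * (X x ^ 2 - 16 * X x ^ 3 + 64 * X x ^ 4 - 64 * X x ^ 5)" if "x \<in> G" for x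
  proof -
    have "norm x < 1" using that by (simp add: G_def)
    from X_deriv_square[OF this] show ?thesis unfolding Y_def by algebra
  qed
  \<comment> \<open>\<open>D (V Y)\<close> is computed by the product rule; \<open>B\<close> below
    supplies \<open>D Y\<close> from the derivative of \<open>Y ^ 2\<close>.\<close>
  have dW: "dX V q * deriv X q * Y q + V q * y1 = deriv Z_ld q"
    by (rule has_field_derivative_unique_on_open[OF open_G q(1) VY])
       (use nq in \<open>auto intro!: derivative_eq_intros G_deriv Y' q holomorphic_derivI[OF holomorphic_Z_ld]\<close>)
  have A: "dX V q * Y q ^ 2 + V q * (q * y1) = q * deriv Z_ld q"
    unfolding dW [symmetric] by (simp add: Y_def power2_eq_square algebra_simps)
  have "2 * Y q * y1 = 2 * Z q * (Z q * V q * deriv X q) * h + Z q ^ 2 * (h' * deriv X q)"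
    by (rule has_field_derivative_unique_on_open[OF open_G q(1) Y2])
       (use q in \<open>auto intro!: derivative_eq_intros G_deriv Y' simp: h_def h'_def algebra_simps\<close>)
  then have "Y q * (2 * (q * y1)) = Y q * (2 * V q * (Z q ^ 2 * h) + Z q ^ 2 * h')"
    unfolding Y_def by algebra
  then have B: "2 * (q * y1) = 2 * V q * (Z q ^ 2 * h) + Z q ^ 2 * h'"
    using q nq by (simp add: Y_def)
  have C: "Y q ^ 2 = Z q ^ 2 * h"
    using Y2[OF q(1)] by (simp add: h_def)
  have "2 * (q * deriv Z_ld q) - (V q * Y q) ^ 2 = Z q ^ 2 * (8 * X q - 80 * X q ^ 2 + 144 * X q ^ 3)"
    using Z_ld_equation[OF nq(1) q(2)] VY[OF q(1)] by simp
  then have "Z q ^ 2 * (2 * h * dX V q + h * V q ^ 2 + h' * V q) =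
      Z q ^ 2 * (8 * X q - 80 * X q ^ 2 + 144 * X q ^ 3)"
    using A B C by algebra
  then show ?thesis
    using Z_nonzero[OF nq(1)] by (simp add: h_def h'_def)
qed

text \<open>The origin is recovered by continuity, all terms being holomorphic on
  \<open>G\<close>.\<close>

lemma riccati:
  assumes q: "q \<in> G"
  shows "2 * (X q ^ 2 - 16 * X q ^ 3 + 64 * X q ^ 4 - 64 * X q ^ 5) * dX V q
       + (X q ^ 2 - 16 * X q ^ 3 + 64 * X q ^ 4 - 64 * X q ^ 5) * V q ^ 2
       + (2 * X q - 48 * X q ^ 2 + 256 * X q ^ 3 - 320 * X q ^ 4) * V q
       - (8 * X q - 80 * X q ^ 2 + 144 * X q ^ 3) = 0" (is "?F q = 0")
proof (cases "q = 0")
  case True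
  have "?F holomorphic_on G"
    by (intro holomorphic_intros holomorphic_G)
  then have "isCont ?F q"
    using continuous_on_eq_continuous_at[OF open_G] holomorphic_on_imp_continuous_on q by blast
  then have "(?F \<longlongrightarrow> ?F q) (at q)"
    by (simp add: isCont_def)
  moreover have "\<forall>\<^sub>F x in at q. ?F x = 0"
    using eventually_at_in_open[OF open_G q]
    by eventually_elim (use True riccati_punctured in auto)
  then have "(?F \<longlongrightarrow> 0) (at q)"
    by (rule tendsto_eventually)
  ultimately show ?thesis
    by (intro tendsto_unique[of "at q" ?F]) auto
qed (use riccati_punctured q in simp)

text \<open>The chain rule gives the \<open>X\<close>-derivative of the Riccati equation times
  \<open>deriv X q\<close>, which is nonzero on \<open>G\<close>.\<close>

lemma riccati_deriv:
  assumes q: "q \<in> G"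
  shows "2 * (X q ^ 2 - 16 * X q ^ 3 + 64 * X q ^ 4 - 64 * X q ^ 5) * dX (dX V) q
       + (2 * X q - 48 * X q ^ 2 + 256 * X q ^ 3 - 320 * X q ^ 4) * (3 * dX V q + V q ^ 2)
       + 2 * (X q ^ 2 - 16 * X q ^ 3 + 64 * X q ^ 4 - 64 * X q ^ 5) * V q * dX V q
       + (2 - 96 * X q + 768 * X q ^ 2 - 1280 * X q ^ 3) * V q
       - (8 - 160 * X q + 432 * X q ^ 2) = 0" (is "?F = 0")
proof -
  have "?F * deriv X q = 0"
    by (rule has_field_derivative_unique_on_open[OF open_G q riccati])
       (auto intro!: derivative_eq_intros G_deriv q simp: algebra_simps power2_eq_square power3_eq_cube)
  then show ?thesis using q by (simp add: G_def)
qed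

lemma dX_Z:
  assumes q: "q \<in> G"
  shows "dX Z q = Z q * V q" "(dX ^^ 2) Z q = Z q * (V q ^ 2 + dX V q)"
    "(dX ^^ 3) Z q = Z q * (V q ^ 3 + 3 * V q * dX V q + dX (dX V) q)"
proof -
  have X: "deriv X x \<noteq> 0" if "x \<in> G" for x using that by (simp add: G_def)
  have 1: "dX Z x = Z x * V x" if "x \<in> G" for x
    using that Z_nonzero by (simp add: V_def G_def)
  show "dX Z q = Z q * V q" by (rule 1[OF q])
  have 2: "dX (dX Z) x = Z x * (V x ^ 2 + dX V x)" if x: "x \<in> G" for x
    by (rule dX_eqI[OF open_G x 1 [symmetric] X[OF x]])
       (auto intro!: derivative_eq_intros G_deriv x simp: algebra_simps power2_eq_square)
  show "(dX ^^ 2) Z q = Z q * (V q ^ 2 + dX V q)"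
    using 2[OF q] by (simp add: numeral_2_eq_2)
  have "dX (dX (dX Z)) q = Z q * (V q ^ 3 + 3 * V q * dX V q + dX (dX V) q)"
    by (rule dX_eqI[OF open_G q 2 [symmetric] X[OF q]])
       (auto intro!: derivative_eq_intros G_deriv q simp: algebra_simps power2_eq_square power3_eq_cube)
  then show "(dX ^^ 3) Z q = Z q * (V q ^ 3 + 3 * V q * dX V q + dX (dX V) q)"
    by (simp add: numeral_3_eq_3)
qed

lemma Z_differential_equation:
  assumes q: "q \<in> G"
  shows "X q ^ 2 * (1 - 4 * X q) * (1 - 12 * X q + 16 * X q ^ 2) * (dX ^^ 3) Z q
         + 3 * X q * (1 - 24 * X q + 128 * X q ^ 2 - 160 * X q ^ 3) * (dX ^^ 2) Z q
         + (1 - 56 * X q + 464 * X q ^ 2 - 784 * X q ^ 3) * dX Z q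
         - 4 * (1 - 20 * X q + 54 * X q ^ 2) * Z q = 0" (is "?L = 0")
proof -
  \<comment> \<open>Twice the left side is \<open>Z\<close> times the sum of the differentiated
    Riccati equation and \<open>2 V\<close> times the Riccati equation.\<close>
  have "2 * ?L = 0"
    unfolding dX_Z[OF q] using riccati[OF q] riccati_deriv[OF q] by algebra
  from mult_eq_0_iff[THEN iffD1, OF this] show ?thesis
    by (rule disjE) simp_all
qed

end

theorem theorem3p4:
  fixes q :: complex
  assumes "norm q < 1"
    and "Z q \<noteq> 0"
    and "deriv X q \<noteq> 0"
  shows "X q ^ 2 * (1 - 4 * X q) * (1 - 12 * X q + 16 * X q ^ 2) * (dX ^^ 3) Z q
         + 3 * X q * (1 - 24 * X q + 128 * X q ^ 2 - 160 * X q ^ 3) * (dX ^^ 2) Z q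
         + (1 - 56 * X q + 464 * X q ^ 2 - 784 * X q ^ 3) * dX Z q
         - 4 * (1 - 20 * X q + 54 * X q ^ 2) * Z q = 0"
  using assms by (intro Z_differential_equation) simp

end
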